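(* Let $b,c$ be positive integers. For each $(a_1,a_2)\in\mathbb{Z}^2$ there exists a unique element in the quantum cluster algebra $\mathcal{A}_v(b,c)$ pointed at $(a_1,a_2)$ whose coefficients $e(p,q)$ satisfy the following recurrence relation: $e(0,0)=1$ and, for $(p,q)\in\mathbb{Z}_{\ge0}^2\setminus\{(0,0)\}$, $$e(p,q)=\begin{cases}\displaystyle\sum_{k=1}^p(-1)^{k-1}e(p-k,q){[a_2-cq]_++k-1\brack k}_{v^b} & \text{if } ca_1q\le ba_2p;\\[2ex] \displaystyle\sum_{\ell=1}^q(-1)^{\ell-1}e(p,q-\ell){[a_1-bp]_++\ell-1\brack \ell}_{v^c} & \text{if } ca_1q\ge ba_2p.\end{cases}$$ (When $ca_1q=ba_2p$ both equalities are required to hold.)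
   Context: Let $\mathcal{T}=\mathbb{Z}[v^{\pm1}]\langle X_1^{\pm1},X_2^{\pm1}: X_2X_1=v^2X_1X_2\rangle$ be the quantum torus and $\mathcal{F}$ its skew-field of fractions. The quantum cluster algebra $\mathcal{A}_v(b,c)$ is the $\mathbb{Z}[v^{\pm1}]$-subalgebra of $\mathcal{F}$ generated by the quantum cluster variables $\{X_m\}_{m\in\mathbb{Z}}$, defined recursively from $X_1,X_2$ by $X_{m+1}X_{m-1}=v^bX_m^b+1$ if $m$ is odd and $X_{m+1}X_{m-1}=v^cX_m^c+1$ if $m$ is even. It is known that $\mathcal{A}_v(b,c)\subset\mathcal{T}$. For $(a_1,a_2)\in\mathbb{Z}^2$ put $X_1^{(a_1,a_2)}=v^{a_1a_2}X_1^{a_1}X_2^{a_2}\in\mathcal{T}$. An element $X\in\mathcal{A}_v(b,c)$ is pointed at $(a_1,a_2)\in\mathbb{Z}^2$ if it has the form $X=\sum_{p,q\ge0}e(p,q)X_1^{(bp-a_1,\,cq-a_2)}$ (a finite sum) with $e(0,0)=1$ and $e(p,q)\in\mathbb{Z}[v^{\pm1}]$ for all $p,q$. $[a]_+=\max(a,0)$. For an invertible formal variable $w$, $n\in\mathbb{Z}$ and $k\in\mathbb{Z}_{\ge0}$: $[n]_w=\frac{w^n-w^{-n}}{w-w^{-1}}$ and ${n\brack k}_w=\frac{[n]_w[n-1]_w\cdots[n-k+1]_w}{[k]_w[k-1]_w\cdots[1]_w}$, a Laurent polynomial in $w$. *)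

theory Defs
  imports
    "HOL-Library.Poly_Mapping"
    "HOL-Computational_Algebra.Fraction_Field"
    "HOL-Computational_Algebra.Polynomial_Factorial"
begin

section \<open>Laurent polynomials and quantum binomial coefficients\<close>

text \<open>
  The ring of integer Laurent polynomials in \<open>v\<close> is the group ring of the integers; a mapping
  sends the exponent of \<open>v\<close> to its coefficient.
\<close>

type_synonym laurent = "int \<Rightarrow>\<^sub>0 int"

definition vpow :: "int \<Rightarrow> laurent" where
  "vpow i = Poly_Mapping.single i 1"

text \<open>
  The quantum integers and binomials are quotients, so they are formed in a field containing \<open>w\<close>;
  below this is the fraction field of \<^typ>\<open>laurent\<close>, with \<open>w\<close> a positive power of \<open>v\<close>.
\<close>

definition qint :: "'a::field \<Rightarrow> int \<Rightarrow> 'a" where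
  "qint w n = (w powi n - w powi (- n)) / (w - inverse w)"

definition qbinom :: "'a::field \<Rightarrow> int \<Rightarrow> nat \<Rightarrow> 'a" where
  "qbinom w n k = (\<Prod>i<k. qint w (n - int i)) / (\<Prod>i<k. qint w (int k - int i))"


section \<open>The quantum torus\<close>

text \<open>
  \<open>Heis i j k\<close> stands for the monomial \<open>v\<^sup>i X\<^sub>1\<^sup>j X\<^sub>2\<^sup>k\<close>. By the relation
  \<open>X\<^sub>2 X\<^sub>1 = v\<^sup>2 X\<^sub>1 X\<^sub>2\<close> (with \<open>v\<close> central) these monomials form a group, written additively here
  although it is not commutative, because the convolution product of \<^type>\<open>poly_mapping\<close> expects
  additive exponents. The quantum torus is the integral group ring of this group.
\<close>

datatype heis = Heis int int int

instantiation heis :: group_add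
begin

definition zero_heis :: heis where
  "0 = Heis 0 0 0"

fun plus_heis :: "heis \<Rightarrow> heis \<Rightarrow> heis" where
  "Heis i j k + Heis i' j' k' = Heis (i + i' + 2 * k * j') (j + j') (k + k')"

fun uminus_heis :: "heis \<Rightarrow> heis" where
  "- Heis i j k = Heis (2 * j * k - i) (- j) (- k)"

definition minus_heis :: "heis \<Rightarrow> heis \<Rightarrow> heis" where
  "x - y = x + (- y :: heis)"

instance
proof
  fix x y z :: heis
  show "x + y + z = x + (y + z)"
    by (cases x; cases y; cases z) (simp add: algebra_simps)
  show "0 + x = x" and "x + 0 = x" and "- x + x = 0"
    by (cases x; simp add: zero_heis_def)+
  show "x + - y = x - y"
    by (simp add: minus_heis_def)
qed

end

type_synonym qtorus = "heis \<Rightarrow>\<^sub>0 int"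

definition tv :: "int \<Rightarrow> qtorus" where
  "tv i = Poly_Mapping.single (Heis i 0 0) 1"

definition tX1 :: "int \<Rightarrow> qtorus" where
  "tX1 j = Poly_Mapping.single (Heis 0 j 0) 1"

definition tX2 :: "int \<Rightarrow> qtorus" where
  "tX2 k = Poly_Mapping.single (Heis 0 0 k) 1"

lemma tX2_tX1: "tX2 1 * tX1 1 = tv 2 * tX1 1 * tX2 1"
  by (simp add: tv_def tX1_def tX2_def mult_single)

lemma
  shows tv_0: "tv 0 = 1" and tv_add: "tv (i + j) = tv i * tv j"
    and tX1_0: "tX1 0 = 1" and tX1_add: "tX1 (i + j) = tX1 i * tX1 j"
    and tX2_0: "tX2 0 = 1" and tX2_add: "tX2 (i + j) = tX2 i * tX2 j"
  by (simp_all add: tv_def tX1_def tX2_def mult_single flip: zero_heis_def single_one)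

lemma single_Heis: "Poly_Mapping.single (Heis i j k) 1 = tv i * tX1 j * tX2 k"
  by (simp add: tv_def tX1_def tX2_def mult_single)

definition torus_scalar :: "laurent \<Rightarrow> qtorus" where
  "torus_scalar r = (\<Sum>i\<in>Poly_Mapping.keys r. of_int (Poly_Mapping.lookup r i) * tv i)"

definition torus_monomial :: "int \<Rightarrow> int \<Rightarrow> qtorus" where
  "torus_monomial a1 a2 = tv (a1 * a2) * tX1 a1 * tX2 a2"


section \<open>The skew-field of fractions\<close>

text \<open>
  \<open>\<iota>\<close> exhibits the division ring \<^typ>\<open>'f\<close> as the skew-field of fractions of \<^typ>\<open>'r\<close>: an embedding
  such that every element is a right fraction. For an Ore domain this determines
  \<^typ>\<open>'f\<close> up to a unique isomorphism over \<^typ>\<open>'r\<close>.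
\<close>

definition skew_field_of_fractions :: "('r::ring_1 \<Rightarrow> 'f::division_ring) \<Rightarrow> bool" where
  "skew_field_of_fractions \<iota> \<longleftrightarrow>
     inj \<iota> \<and> \<iota> 1 = 1 \<and>
     (\<forall>x y. \<iota> (x + y) = \<iota> x + \<iota> y) \<and>
     (\<forall>x y. \<iota> (x * y) = \<iota> x * \<iota> y) \<and>
     (\<forall>z. \<exists>x y. y \<noteq> 0 \<and> z = \<iota> x * inverse (\<iota> y))"


section \<open>The quantum cluster algebra\<close>

context
  fixes \<iota> :: "qtorus \<Rightarrow> 'f::division_ring" and b c :: nat
begin

definition exchange_rhs :: "int \<Rightarrow> 'f \<Rightarrow> 'f" where
  "exchange_rhs m x =
     (if odd m then \<iota> (tv (int b)) * x ^ b + 1 else \<iota> (tv (int c)) * x ^ c + 1)"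

text \<open>
  The exchange relation \<open>X\<^bsub>m+1\<^esub> X\<^bsub>m-1\<^esub> = exchange_rhs m X\<^sub>m\<close>, solved for \<open>X\<^bsub>m+1\<^esub>\<close> and for \<open>X\<^bsub>m-1\<^esub>\<close>:
  \<open>cluster_up n\<close> is \<open>X\<^bsub>n+1\<^esub>\<close> and \<open>cluster_down n\<close> is \<open>X\<^bsub>2-n\<^esub>\<close>.
\<close>

fun cluster_up :: "nat \<Rightarrow> 'f" where
  "cluster_up 0 = \<iota> (tX1 1)"
| "cluster_up (Suc 0) = \<iota> (tX2 1)"
| "cluster_up (Suc (Suc n)) =
     exchange_rhs (int n + 2) (cluster_up (Suc n)) * inverse (cluster_up n)"

fun cluster_down :: "nat \<Rightarrow> 'f" where
  "cluster_down 0 = \<iota> (tX2 1)"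
| "cluster_down (Suc 0) = \<iota> (tX1 1)"
| "cluster_down (Suc (Suc n)) =
     inverse (cluster_down n) * exchange_rhs (1 - int n) (cluster_down (Suc n))"

definition cluster_var :: "int \<Rightarrow> 'f" where
  "cluster_var m = (if m \<ge> 1 then cluster_up (nat (m - 1)) else cluster_down (nat (2 - m)))"

lemma cluster_var_1: "cluster_var 1 = \<iota> (tX1 1)"
  and cluster_var_2: "cluster_var 2 = \<iota> (tX2 1)"
  by (simp_all add: cluster_var_def)

lemma cluster_var_exchange:
  assumes "cluster_var (m - 1) \<noteq> 0" "cluster_var (m + 1) \<noteq> 0"
  shows "cluster_var (m + 1) * cluster_var (m - 1) = exchange_rhs m (cluster_var m)"
proof (cases "m \<ge> 2")
  case True
  define n where "n = nat (m - 2)"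
  have m: "m = int n + 2" using True by (simp add: n_def)
  have "cluster_var (m + 1) = cluster_up (Suc (Suc n))" "cluster_var m = cluster_up (Suc n)"
    "cluster_var (m - 1) = cluster_up n"
    by (simp_all add: cluster_var_def m nat_add_distrib)
  with assms show ?thesis by (simp add: m mult.assoc)
next
  case False
  define n where "n = nat (1 - m)"
  have m: "m = 1 - int n" using False by (simp add: n_def)
  have down: "cluster_var k = cluster_down (nat (2 - k))" if le: "k \<le> 2" for k
  proof -
    consider "k = 1" | "k = 2" | "k < 1" using le by linarith
    then show ?thesis by cases (simp_all add: cluster_var_def)
  qed
  have "cluster_var (m + 1) = cluster_down n" "cluster_var m = cluster_down (Suc n)"
    "cluster_var (m - 1) = cluster_down (Suc (Suc n))"
    by (simp_all add: down m nat_add_distrib)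
  with assms show ?thesis by (simp add: m flip: mult.assoc)
qed

inductive_set quantum_cluster_algebra :: "'f set" where
  scalar: "\<iota> (torus_scalar r) \<in> quantum_cluster_algebra"
| var: "cluster_var m \<in> quantum_cluster_algebra"
| add: "x \<in> quantum_cluster_algebra \<Longrightarrow> y \<in> quantum_cluster_algebra \<Longrightarrow>
    x + y \<in> quantum_cluster_algebra"
| mult: "x \<in> quantum_cluster_algebra \<Longrightarrow> y \<in> quantum_cluster_algebra \<Longrightarrow>
    x * y \<in> quantum_cluster_algebra"

definition pointed_with ::
    "int \<Rightarrow> int \<Rightarrow> (nat \<Rightarrow> nat \<Rightarrow> laurent) \<Rightarrow> 'f \<Rightarrow> bool" where
  "pointed_with a1 a2 e x \<longleftrightarrow>
     x \<in> quantum_cluster_algebra \<and> e 0 0 = 1 \<and> finite {(p, q). e p q \<noteq> 0} \<and>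
     x = \<iota> (\<Sum>(p, q)\<in>{(p, q). e p q \<noteq> 0}.
             torus_scalar (e p q) *
             torus_monomial (int b * int p - a1) (int c * int q - a2))"

end

end

theory Submission
  imports
    Defs
    "HOL-Computational_Algebra.Formal_Power_Series"
    "HOL-Library.Product_Plus"
begin

text \<open>
  The recurrence determines \<open>e\<close>, so the issue is existence. Write \<open>P = b p\<close> and \<open>Q = c q\<close>. The first
  equation at \<open>(p, q)\<close> says that the coefficient of \<open>t\<^sup>p\<close> vanishes in the row series
  \<open>\<Sum>\<^sub>p e(p, q) t\<^sup>p\<close> divided by the product of \<open>[a\<^sub>2 - Q]\<^sub>+\<close> factors \<open>1 + v\<^sup>i t\<close>; the second says the same for
  columns. Hence rows with \<open>Q < a\<^sub>2\<close> and columns with \<open>P < a\<^sub>1\<close> are divisible by the products that make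
  the element a Laurent polynomial in \<open>X\<^sub>0, X\<^sub>1\<close> and in \<open>X\<^sub>2, X\<^sub>3\<close>, the support is finite, and such an
  element lies in the subalgebra generated by \<open>X\<^sub>0, X\<^sub>1, X\<^sub>2, X\<^sub>3\<close>: subtracting multiples of
  \<open>X\<^sub>3\<^sup>k X\<^sub>0\<^sup>n\<close> removes the highest power of \<open>X\<^sub>0\<close>.

  There remain the points with \<open>a\<^sub>1 Q = a\<^sub>2 P\<close>, where both equations are required. Off the rectangle
  \<open>P < a\<^sub>1, Q < a\<^sub>2\<close> both are trivial. Inside it the truncations \<open>[\<dots>]\<^sub>+\<close> are inactive, and dividing a row
  (column) by its product is conjugation by a quantum dilogarithm \<open>E\<^sub>1\<close> of \<open>X\<^sub>1\<^sup>b\<close> (\<open>E\<^sub>2\<close> of \<open>X\<^sub>2\<^sup>c\<close>) in the completed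
  quantum plane. Factor \<open>E\<^sub>1 E\<^sub>2 = C\<^sup>-\<^sup>1 A D\<^sup>-\<^sup>1\<close> with \<open>C, A, D\<close> supported strictly above, on, and strictly
  below the line \<open>a\<^sub>1 Q = a\<^sub>2 P\<close>, apart from the constant term \<open>1\<close>. The series \<open>A\<close> commutes with \<open>z = X\<^sub>1^(-a\<^sub>1,-a\<^sub>2)\<close>, so
  \<open>x = E\<^sub>1\<^sup>-\<^sup>1 C\<^sup>-\<^sup>1 z C E\<^sub>1 = E\<^sub>2 D z D\<^sup>-\<^sup>1 E\<^sub>2\<^sup>-\<^sup>1\<close>, and both conjugates of \<open>x\<close> have no coefficient other
  than the leading one on the line.
\<close>

section \<open>Laurent coefficients\<close>

lemma vpow_0 [simp]: "vpow 0 = 1"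
  by (simp add: vpow_def)

lemma vpow_add: "vpow (i + j) = vpow i * vpow j"
  by (simp add: vpow_def mult_single)

lemma vpow_eq_iff [simp]: "vpow i = vpow j \<longleftrightarrow> i = j"
proof
  assume "vpow i = vpow j"
  then have "Poly_Mapping.lookup (vpow i) j = Poly_Mapping.lookup (vpow j) j" by simp
  then show "i = j" by (simp add: vpow_def lookup_single when_def split: if_splits)
qed simp

lemma vpow_power: "vpow i ^ n = vpow (int n * i)"
  by (induction n) (simp_all add: algebra_simps flip: vpow_add)

abbreviation vf :: "int \<Rightarrow> laurent fract" where
  "vf i \<equiv> to_fract (vpow i)"

lemma vf_add: "vf (i + j) = vf i * vf j"
  by (simp add: vpow_add)

lemma vf_neq_0 [simp]: "vf i \<noteq> 0"
proof
  assume "vf i = 0"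
  moreover have "vf i * vf (- i) = 1" by (simp flip: vf_add to_fract_mult vpow_add)
  ultimately show False by simp
qed

lemma inverse_vf: "inverse (vf i) = vf (- i)"
  by (rule inverse_unique) (simp flip: to_fract_mult vpow_add)

lemma vf_power: "vf i ^ n = vf (int n * i)"
  by (induction n) (simp_all add: algebra_simps flip: to_fract_mult vpow_add)

lemma vf_powi: "vf i powi n = vf (n * i)"
  by (cases "n \<ge> 0") (simp_all add: power_int_def vf_power power_inverse inverse_vf)

lemma vf_eq_1_iff: "vf i = 1 \<longleftrightarrow> i = 0"
  using to_fract_eq_iff[of "vpow i" 1] vpow_eq_iff[of i 0] by (simp del: vpow_eq_iff)

text \<open>The Pascal rule of the symmetric Gaussian binomial in \<open>v^b\<close> serves as
  definition because it stays inside the Laurent polynomials, whereas \<open>qbinom\<close> is a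
  quotient.\<close>

fun lbin :: "int \<Rightarrow> nat \<Rightarrow> nat \<Rightarrow> laurent" where
  "lbin b n 0 = 1"
| "lbin b 0 (Suc k) = 0"
| "lbin b (Suc n) (Suc k) =
     vpow (b * (int k + 1)) * lbin b n (Suc k) + vpow (b * (int k - int n)) * lbin b n k"

lemma lbin_eq_0: "n < k \<Longrightarrow> lbin b n k = 0"
  by (induction b n k rule: lbin.induct) auto

text \<open>The quotient obeys the same Pascal rule, which comes down to one identity between three
  quantum integers; \<open>b \<noteq> 0\<close> keeps the denominators from vanishing.\<close>

lemma qbinom_lbin:
  assumes "b \<noteq> 0"
  shows "qbinom (vf b) (int n) k = to_fract (lbin b n k)"
proof -
  define w where "w = vf b"
  define N where "N = (\<lambda>(m::int) k. \<Prod>i<k. qint w (m - int i))"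
  define d where "d = (\<lambda>k. \<Prod>i<k. qint w (int k - int i))"
  have w2: "w - inverse w \<noteq> 0"
    using assms by (simp add: w_def inverse_vf)
  have qint_eq: "qint w m = (vf (m * b) - vf (- (m * b))) / (w - inverse w)" for m
    by (simp add: qint_def w_def vf_powi)
  have qint0: "qint w 0 = 0" by (simp add: qint_eq)
  have qint_neq_0: "qint w m \<noteq> 0" if "m \<noteq> 0" for m
    using w2 that assms by (simp add: qint_eq)
  have N_Suc: "N (m + 1) (Suc k) = qint w (m + 1) * N m k" for m k
    unfolding N_def by (subst prod.lessThan_Suc_shift) simp
  have N_Suc': "N m (Suc k) = N m k * qint w (m - int k)" for m k
    unfolding N_def by simp
  have d_Suc: "d (Suc k) = qint w (int k + 1) * d k" for k
    unfolding d_def by (subst prod.lessThan_Suc_shift) (simp add: add.commute)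
  have d_neq_0: "d k \<noteq> 0" for k
    unfolding d_def by (auto intro!: qint_neq_0)
  have qb: "qbinom w m k = N m k / d k" for m k
    by (simp add: qbinom_def N_def d_def)
  have pascal_qint: "qint w (n + 1) = vf (b * (k + 1)) * qint w (n - k) + vf (b * (k - n)) * qint w (k + 1)"
    for n k
  proof -
    have "vf ((n + 1) * b) - vf (- ((n + 1) * b)) =
      vf (b * (k + 1)) * (vf ((n - k) * b) - vf (- ((n - k) * b))) +
      vf (b * (k - n)) * (vf ((k + 1) * b) - vf (- ((k + 1) * b)))"
      by (simp add: right_diff_distrib flip: to_fract_mult vpow_add to_fract_diff to_fract_add)
        (simp add: algebra_simps)
    then show ?thesis
      by (simp add: qint_eq flip: add_divide_distrib)
  qed
  have split_fraction: "(x * y + z * q) * u / (q * t) = x * (u * y / (q * t)) + z * (u / t)"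
    if "q \<noteq> 0" "t \<noteq> 0" for x y z q u t :: "laurent fract"
    using that by (simp add: field_simps)
  have "qbinom w (int n) k = to_fract (lbin b n k)"
  proof (induction n arbitrary: k)
    case 0
    have "N 0 (Suc k) = 0" for k unfolding N_def by (subst prod.lessThan_Suc_shift) (simp add: qint0)
    then show ?case by (cases k) (simp_all add: qb, simp add: N_def d_def)
  next
    case (Suc n k')
    show ?case
    proof (cases k')
      case 0
      then show ?thesis by (simp add: qbinom_def)
    next
    case k': (Suc k)
    have "qbinom w (int (Suc n)) (Suc k) = qint w (int n + 1) * N (int n) k / (qint w (int k + 1) * d k)"
      using N_Suc[of "int n"] by (simp add: qb d_Suc add.commute)
    also have "\<dots> = vf (b * (int k + 1)) * (N (int n) k * qint w (int n - int k) / (qint w (int k + 1) * d k)) +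
        vf (b * (int k - int n)) * (N (int n) k / d k)"
      unfolding pascal_qint[of "int n" "int k"]
      by (rule split_fraction) (use d_neq_0 qint_neq_0[of "int k + 1"] in auto)
    also have "\<dots> = vf (b * (int k + 1)) * qbinom w (int n) (Suc k) + vf (b * (int k - int n)) * qbinom w (int n) k"
      by (simp add: qb N_Suc' d_Suc)
    finally show ?thesis by (simp only: k' Suc.IH to_fract_add to_fract_mult lbin.simps)
    qed
  qed
  then show ?thesis by (simp add: w_def)
qed

section \<open>The substitution \<open>t -> w t\<close> in power series, and products of linear
  factors\<close>

definition fscale :: "'a::comm_ring_1 \<Rightarrow> 'a fps \<Rightarrow> 'a fps" where
  "fscale w f = Abs_fps (\<lambda>k. w ^ k * fps_nth f k)"

lemma fscale_nth [simp]: "fps_nth (fscale w f) k = w ^ k * fps_nth f k"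
  by (simp add: fscale_def)

lemma fscale_mult: "fscale w (f * g) = fscale w f * fscale w g"
proof (rule fps_ext)
  fix k
  have "w ^ k * (fps_nth f i * fps_nth g (k - i)) = w ^ i * fps_nth f i * (w ^ (k - i) * fps_nth g (k - i))"
    if "i \<le> k" for i
    using that power_add[of w i "k - i"] by simp
  then show "fps_nth (fscale w (f * g)) k = fps_nth (fscale w f * fscale w g) k"
    by (auto simp: fps_mult_nth sum_distrib_left intro!: sum.cong)
qed

lemma fps_nth_mult_linear:
  "fps_nth (f * (1 + fps_const c * fps_X)) 0 = fps_nth f 0"
  "fps_nth (f * (1 + fps_const c * fps_X)) (Suc k) = fps_nth f (Suc k) + c * fps_nth f k"
  for c :: "'a::comm_ring_1"
proof -
  have *: "f * (1 + fps_const c * fps_X) = f + fps_const c * (fps_X * f)"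
    by (simp add: algebra_simps)
  show "fps_nth (f * (1 + fps_const c * fps_X)) 0 = fps_nth f 0"
    "fps_nth (f * (1 + fps_const c * fps_X)) (Suc k) = fps_nth f (Suc k) + c * fps_nth f k"
    unfolding * by simp_all
qed

lemma fscale_1 [simp]: "fscale w 1 = 1"
  by (rule fps_ext) simp

lemma fscale_fscale: "fscale w (fscale u f) = fscale (w * u) f"
  by (rule fps_ext) (simp add: power_mult_distrib mult_ac)

lemma fscale_linear: "fscale w (1 + fps_const c * fps_X) = 1 + fps_const (w * c) * fps_X"
  by (rule fps_ext) (simp add: fps_X_def)

text \<open>
  \<open>Bser b n\<close> is the product of the \<open>n\<close> factors \<open>1 + v^(b(2j + 1 - n)) t\<close> with \<open>0 \<le> j < n\<close>, and \<open>Hser b n\<close> is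
  its inverse.
\<close>

definition Bser :: "int \<Rightarrow> nat \<Rightarrow> laurent fps" where
  "Bser b n = Abs_fps (lbin b n)"

definition Hser :: "int \<Rightarrow> nat \<Rightarrow> laurent fps" where
  "Hser b n = Abs_fps (\<lambda>k. (-1) ^ k * lbin b (n + k - 1) k)"

text \<open>Rescaling by \<open>v^b\<close> turns the exponents \<open>b(2j + 1 - n)\<close> into
  \<open>b(2j + 2 - n)\<close>. These are the exponents for \<open>n + 1\<close> except the one at
  \<open>j = 0\<close>, which is \<open>-n b\<close>.\<close>

lemma Bser_Suc:
  "Bser b (Suc n) = fscale (vpow b) (Bser b n) * (1 + fps_const (vpow (- (int n * b))) * fps_X)"
proof (rule fps_ext)
  fix k show "fps_nth (Bser b (Suc n)) k = fps_nth (fscale (vpow b) (Bser b n) *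
    (1 + fps_const (vpow (- (int n * b))) * fps_X)) k"
  proof (cases k)
    case (Suc j)
    have "vpow (b * (int j - int n)) = vpow (- (int n * b)) * vpow (int j * b)"
      by (simp add: algebra_simps flip: vpow_add)
    then show ?thesis
      unfolding Suc fps_nth_mult_linear fscale_nth vpow_power
      by (simp add: Bser_def algebra_simps flip: vpow_add)
  qed (simp add: Bser_def)
qed

text \<open>Pascal rule at upper index \<open>n + j + 1\<close>: the sign in \<open>Hser\<close>
  moves its second term to the other side, where it becomes the product with the linear
  factor.\<close>

lemma Hser_Suc:
  "Hser b (Suc n) * (1 + fps_const (vpow (- (int n * b))) * fps_X) = fscale (vpow b) (Hser b n)"
proof (rule fps_ext)
  fix k show "fps_nth (Hser b (Suc n) * (1 + fps_const (vpow (- (int n * b))) * fps_X)) k =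
     fps_nth (fscale (vpow b) (Hser b n)) k"
  proof (cases k)
    case (Suc j)
    have "vpow (b * (int j - int (n + j))) = vpow (- (int n * b))"
      by (simp add: algebra_simps)
    moreover have "Suc n + Suc j - 1 = Suc (n + j)" "n + Suc j - 1 = n + j" "Suc n + j - 1 = n + j"
      by simp_all
    ultimately show ?thesis
      unfolding Suc fps_nth_mult_linear fscale_nth Hser_def fps_nth_Abs_fps vpow_power
      by (simp only: lbin.simps) (simp add: algebra_simps)
  qed (simp add: Hser_def)
qed

lemma Bser_Hser: "Bser b n * Hser b n = 1"
proof (induction n)
  case 0
  have "Bser b 0 = 1"
    by (rule fps_ext) (auto simp: Bser_def lbin_eq_0)
  \<comment> \<open>Truncated subtraction is harmless: at \<open>k = 0\<close> the binomial is 1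
    whatever its upper index, and for \<open>k > 0\<close> the upper index \<open>k - 1\<close> is
    below \<open>k\<close>.\<close>
  moreover have "Hser b 0 = 1"
    by (rule fps_ext) (auto simp: Hser_def lbin_eq_0)
  ultimately show ?case by simp
next
  case (Suc n)
  have "Bser b (Suc n) * Hser b (Suc n) = fscale (vpow b) (Bser b n) * fscale (vpow b) (Hser b n)"
    by (simp add: Bser_Suc flip: Hser_Suc)
  also have "\<dots> = 1" by (simp add: Suc flip: fscale_mult)
  finally show ?case .
qed

section \<open>Passage to the fraction field and the quantum dilogarithm\<close>

definition tofps :: "laurent fps \<Rightarrow> laurent fract fps" where
  "tofps f = Abs_fps (\<lambda>k. to_fract (fps_nth f k))"

lemma tofps_nth [simp]: "fps_nth (tofps f) k = to_fract (fps_nth f k)"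
  by (simp add: tofps_def)

lemma power_to_fract: "to_fract (x ^ n) = to_fract x ^ n"
  by (induction n) simp_all

lemma tofps_mult: "tofps (f * g) = tofps f * tofps g"
  by (rule fps_ext) (simp add: fps_mult_nth to_fract_sum)

lemma tofps_1 [simp]: "tofps 1 = 1"
  by (rule fps_ext) simp

lemma tofps_Bser_Hser: "tofps (Bser b n) * tofps (Hser b n) = 1"
  by (simp add: Bser_Hser flip: tofps_mult)

lemma tofps_fscale: "tofps (fscale w f) = fscale (to_fract w) (tofps f)"
  by (rule fps_ext) (simp add: power_to_fract)

lemma tofps_linear: "tofps (1 + fps_const c * fps_X) = 1 + fps_const (to_fract c) * fps_X"
  by (rule fps_ext) simp

text \<open>The quantum dilogarithm, formally the product of all \<open>1 + v^(b(2j + 1)) t\<close>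
  with \<open>j \<ge> 0\<close>. The recursion is its functional equation solved for the next
  coefficient; this division is what requires the fraction field.\<close>

fun dilog_coeff :: "int \<Rightarrow> nat \<Rightarrow> laurent fract" where
  "dilog_coeff b 0 = 1"
| "dilog_coeff b (Suc k) = dilog_coeff b k * vf (b * (2 * int k + 1)) / (1 - vf (b * (2 * int k + 2)))"

definition dilog :: "int \<Rightarrow> laurent fract fps" where
  "dilog b = Abs_fps (dilog_coeff b)"

lemma dilog_functional_equation:
  assumes "b \<noteq> 0"
  shows "fscale (vf (2 * b)) (dilog b) * (1 + fps_const (vf b) * fps_X) = dilog b"
proof (rule fps_ext)
  fix k show "fps_nth (fscale (vf (2 * b)) (dilog b) * (1 + fps_const (vf b) * fps_X)) k = fps_nth (dilog b) k"
  proof (cases k)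
    case (Suc j)
    have nz: "1 - vf (b * (2 * int j + 2)) \<noteq> 0"
      using assms vf_eq_1_iff[of "b * (2 * int j + 2)"] by auto
    have 1: "vf b * vf (int j * (2 * b)) = vf (b * (2 * int j + 1))"
      "vf (int (Suc j) * (2 * b)) = vf (b * (2 * int j + 2))"
      by (simp_all add: algebra_simps flip: to_fract_mult vpow_add)
    have "fps_nth (fscale (vf (2 * b)) (dilog b) * (1 + fps_const (vf b) * fps_X)) k =
        vf (2 * b) ^ Suc j * dilog_coeff b (Suc j) + vf b * (vf (2 * b) ^ j * dilog_coeff b j)"
      unfolding Suc fps_nth_mult_linear fscale_nth dilog_def fps_nth_Abs_fps ..
    also have "\<dots> = vf (b * (2 * int j + 2)) * dilog_coeff b (Suc j) + vf (b * (2 * int j + 1)) * dilog_coeff b j"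
      by (simp only: vf_power 1 mult.assoc[of "vf b", symmetric])
    also have "\<dots> = dilog_coeff b (Suc j)" using nz by (simp add: divide_simps) (simp add: algebra_simps)
    finally show ?thesis by (simp add: dilog_def Suc)
   qed (simp_all add: dilog_def)
qed

text \<open>The two arguments differ by the factor \<open>v^(2 n b)\<close>, so the functional
  equation telescopes to \<open>n\<close> linear factors; placing the arguments symmetrically makes
  them those of \<open>Bser b n\<close>.\<close>

lemma dilog_Bser:
  assumes "b \<noteq> 0"
  shows "fscale (vf (int n * b)) (dilog b) * tofps (Bser b n) = fscale (vf (- (int n * b))) (dilog b)"
proof (induction n)
  case 0
  have "Bser b 0 = 1"
    by (rule fps_ext) (auto simp: Bser_def lbin_eq_0)
  then show ?case by simp
next
  case (Suc n)
  have "fscale (vf (int (Suc n) * b)) (dilog b) * tofps (Bser b (Suc n)) =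
      fscale (vf b * vf (int n * b)) (dilog b) * fscale (vf b) (tofps (Bser b n)) *
        (1 + fps_const (vf (- (int n * b))) * fps_X)"
    unfolding Bser_Suc tofps_mult tofps_linear tofps_fscale
    by (simp add: algebra_simps vpow_add)
  also have "fscale (vf b * vf (int n * b)) (dilog b) * fscale (vf b) (tofps (Bser b n)) =
      fscale (vf b) (fscale (vf (int n * b)) (dilog b) * tofps (Bser b n))"
    by (simp add: fscale_mult fscale_fscale)
  also have "\<dots> = fscale (vf (b - int n * b)) (dilog b)"
    unfolding Suc fscale_fscale by (simp flip: to_fract_mult vpow_add)
  also have "\<dots> * (1 + fps_const (vf (- (int n * b))) * fps_X) =
      fscale (vf (- (int (Suc n) * b))) (fscale (vf (2 * b)) (dilog b) * (1 + fps_const (vf b) * fps_X))"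
    unfolding fscale_mult fscale_fscale fscale_linear
    by (simp add: algebra_simps flip: to_fract_mult vpow_add)
  finally show ?case by (simp add: dilog_functional_equation assms)
qed

section \<open>The completed quantum plane\<close>

type_synonym bidegree = "nat \<times> nat"

text \<open>
  \<open>qcoeff f (p, q)\<close> is the coefficient of the normalised monomial \<open>v^(p q) X\<^sub>1\<^sup>p X\<^sub>2\<^sup>q\<close>; with this basis the
  product of two monomials is twisted by the alternating form \<open>qform\<close>.
\<close>

datatype qps = QPS (qcoeff: "bidegree \<Rightarrow> laurent fract")

lemma qps_eqI: "(\<And>m. qcoeff f m = qcoeff g m) \<Longrightarrow> f = g"
  by (cases f; cases g) auto

fun qform :: "bidegree \<Rightarrow> bidegree \<Rightarrow> int" where
  "qform (p, q) (p', q') = int q * int p' - int p * int q'"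

lemma qform_add: "qform (m + m') n = qform m n + qform m' n" "qform m (n + n') = qform m n + qform m n'"
  by (cases m; cases m'; cases n; cases n'; simp add: algebra_simps)+

lemma qform_0 [simp]: "qform 0 m = 0" "qform m 0 = 0"
  by (cases m; simp add: zero_prod_def)+

declare qform.simps [simp del]

lemma vf_qform_add: "vf (qform (m + m') n) = vf (qform m n) * vf (qform m' n)"
  "vf (qform m (n + n')) = vf (qform m n) * vf (qform m n')"
  by (simp_all only: qform_add vf_add)

definition splits :: "bidegree \<Rightarrow> (bidegree \<times> bidegree) set" where
  "splits m = {(x, y). x + y = m}"

lemma finite_splits [simp]: "finite (splits m)"
proof (rule finite_subset)
  show "splits m \<subseteq> ({..fst m} \<times> {..snd m}) \<times> ({..fst m} \<times> {..snd m})"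
    by (auto simp: splits_def)
qed auto

instantiation qps :: ring_1
begin

definition zero_qps :: qps where "0 = QPS (\<lambda>_. 0)"
definition one_qps :: qps where "1 = QPS (\<lambda>m. if m = 0 then 1 else 0)"
definition plus_qps :: "qps \<Rightarrow> qps \<Rightarrow> qps" where "f + g = QPS (\<lambda>m. qcoeff f m + qcoeff g m)"
definition minus_qps :: "qps \<Rightarrow> qps \<Rightarrow> qps" where "f - g = QPS (\<lambda>m. qcoeff f m - qcoeff g m)"
definition uminus_qps :: "qps \<Rightarrow> qps" where "- f = QPS (\<lambda>m. - qcoeff f m)"
definition times_qps :: "qps \<Rightarrow> qps \<Rightarrow> qps" where
  "f * g = QPS (\<lambda>m. \<Sum>(x, y)\<in>splits m. vf (qform x y) * qcoeff f x * qcoeff g y)"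

lemma qcoeff_simps [simp]:
  "qcoeff 0 m = 0" "qcoeff 1 m = (if m = 0 then 1 else 0)"
  "qcoeff (f + g) m = qcoeff f m + qcoeff g m"
  "qcoeff (f - g) m = qcoeff f m - qcoeff g m"
  "qcoeff (- f) m = - qcoeff f m"
  by (simp_all add: zero_qps_def one_qps_def plus_qps_def minus_qps_def uminus_qps_def)

lemma qcoeff_mult:
  "qcoeff (f * g) m = (\<Sum>(x, y)\<in>splits m. vf (qform x y) * qcoeff f x * qcoeff g y)"
  by (simp add: times_qps_def)

instance
proof
  fix f g h :: qps
  show "f * g * h = f * (g * h)"
  proof (rule qps_eqI)
    fix m
    let ?T = "\<lambda>x y z. vf (qform x y) * vf (qform x z) * vf (qform y z) * qcoeff f x * qcoeff g y * qcoeff h z"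
    \<comment> \<open>By bilinearity of \<open>qform\<close>, either bracketing carries the twist of
      all three pairs.\<close>
    have *: "vf (qform (fst p) (snd p)) * vf (qform u z) = vf (qform (fst p) (snd p)) * vf (qform (fst p) z) * vf (qform (snd p) z)"
      "vf (qform (fst p) (snd p)) * vf (qform z u) = vf (qform z (fst p)) * vf (qform z (snd p)) * vf (qform (fst p) (snd p))"
      if "p \<in> splits u" for p u z
    proof -
      have "u = fst p + snd p" using that by (auto simp: splits_def)
      then show "vf (qform (fst p) (snd p)) * vf (qform u z) = vf (qform (fst p) (snd p)) * vf (qform (fst p) z) * vf (qform (snd p) z)"
      "vf (qform (fst p) (snd p)) * vf (qform z u) = vf (qform z (fst p)) * vf (qform z (snd p)) * vf (qform (fst p) (snd p))"
        by (simp_all only: vf_qform_add mult_ac)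
    qed
    have "qcoeff (f * g * h) m = (\<Sum>p\<in>splits m. \<Sum>p'\<in>splits (fst p). 
        (vf (qform (fst p') (snd p')) * vf (qform (fst p) (snd p))) * qcoeff f (fst p') * qcoeff g (snd p') * qcoeff h (snd p))"
      by (simp add: qcoeff_mult split_def sum_distrib_left sum_distrib_right mult_ac)
    also have "\<dots> = (\<Sum>p\<in>splits m. \<Sum>p'\<in>splits (fst p). ?T (fst p') (snd p') (snd p))"
      by (intro sum.cong refl) (simp only: *)
    also have "\<dots> = (\<Sum>p\<in>splits m. \<Sum>p'\<in>splits (snd p). ?T (fst p) (fst p') (snd p'))"
      by (subst (1 2) sum.Sigma, simp, simp, simp, simp)
        (rule sum.reindex_bij_witness[of _ "\<lambda>((x, u), (y, z)). ((x + y, z), (x, y))"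
            "\<lambda>((u, z), (x, y)). ((x, y + z), (y, z))"];
          force simp: splits_def add.assoc)
    also have "\<dots> = (\<Sum>p\<in>splits m. \<Sum>p'\<in>splits (snd p). 
        (vf (qform (fst p') (snd p')) * vf (qform (fst p) (snd p))) * qcoeff f (fst p) * qcoeff g (fst p') * qcoeff h (snd p'))"
      by (intro sum.cong refl) (simp only: *)
    also have "\<dots> = qcoeff (f * (g * h)) m"
      by (simp add: qcoeff_mult split_def sum_distrib_left sum_distrib_right mult_ac)
    finally show "qcoeff (f * g * h) m = qcoeff (f * (g * h)) m" .
  qed
  show "(f + g) * h = f * h + g * h" "f * (g + h) = f * g + f * h"
    by (rule qps_eqI; simp add: qcoeff_mult split_def algebra_simps sum.distrib)+
  show "1 * f = f"
  proof (rule qps_eqI)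
    fix m
    have *: "\<forall>p\<in>splits m - {(0, m)}. (case p of (x, y) \<Rightarrow> vf (qform x y) * qcoeff 1 x * qcoeff f y) = 0"
    proof
      fix p assume p: "p \<in> splits m - {(0, m)}"
      obtain x y where xy: "p = (x, y)" by (cases p)
      then have "x \<noteq> 0" using p by (metis (mono_tags, lifting) CollectD Diff_iff add_0 case_prodD singletonI splits_def)
      then show "(case p of (x, y) \<Rightarrow> vf (qform x y) * qcoeff 1 x * qcoeff f y) = 0" by (simp add: xy)
    qed
    have "(\<Sum>(x, y)\<in>splits m. vf (qform x y) * qcoeff 1 x * qcoeff f y) =
        (\<Sum>(x, y)\<in>{(0, m)}. vf (qform x y) * qcoeff 1 x * qcoeff f y)"
      by (rule sum.mono_neutral_right) (simp, simp add: splits_def, rule *)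
    then show "qcoeff (1 * f) m = qcoeff f m" by (simp add: qcoeff_mult)
  qed
  show "f * 1 = f"
  proof (rule qps_eqI)
    fix m
    have *: "\<forall>p\<in>splits m - {(m, 0)}. (case p of (x, y) \<Rightarrow> vf (qform x y) * qcoeff f x * qcoeff 1 y) = 0"
    proof
      fix p assume p: "p \<in> splits m - {(m, 0)}"
      obtain x y where xy: "p = (x, y)" by (cases p)
      then have "y \<noteq> 0" using p by (metis (mono_tags, lifting) CollectD Diff_iff add.right_neutral case_prodD singletonI splits_def)
      then show "(case p of (x, y) \<Rightarrow> vf (qform x y) * qcoeff f x * qcoeff 1 y) = 0" by (simp add: xy)
    qed
    have "(\<Sum>(x, y)\<in>splits m. vf (qform x y) * qcoeff f x * qcoeff 1 y) =
        (\<Sum>(x, y)\<in>{(m, 0)}. vf (qform x y) * qcoeff f x * qcoeff 1 y)"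
      by (rule sum.mono_neutral_right) (simp, simp add: splits_def, rule *)
    then show "qcoeff (f * 1) m = qcoeff f m" by (simp add: qcoeff_mult)
  qed
  show "(0::qps) \<noteq> 1"
    by (metis qcoeff_simps(1,2) zero_neq_one)
qed (rule qps_eqI; simp add: algebra_simps)+

end

section \<open>Series with prescribed support: elimination of coefficients and inverses\<close>

lemma qcoeff_mult_split0:
  "m \<noteq> 0 \<Longrightarrow> qcoeff (f * g) m = qcoeff f m * qcoeff g 0 +
     (\<Sum>(x, y)\<in>splits m - {(m, 0)}. vf (qform x y) * qcoeff f x * qcoeff g y)"
  unfolding qcoeff_mult
  by (subst sum.remove[of _ "(m, 0)"]) (simp, simp add: splits_def, simp)

lemma qcoeff_mult_split1:
  "m \<noteq> 0 \<Longrightarrow> qcoeff (f * g) m = qcoeff f 0 * qcoeff g m +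
     (\<Sum>(x, y)\<in>splits m - {(0, m)}. vf (qform x y) * qcoeff f x * qcoeff g y)"
  unfolding qcoeff_mult
  by (subst sum.remove[of _ "(0, m)"]) (simp, simp add: splits_def, simp)

lemma qcoeff_mult_0: "qcoeff (f * g) 0 = qcoeff f 0 * qcoeff g 0"
proof -
  have "splits 0 = {(0, 0)}" by (auto simp: splits_def zero_prod_def)
  then show ?thesis by (simp add: qcoeff_mult)
qed

definition unipotent :: "bidegree set \<Rightarrow> qps set" where
  "unipotent S = {f. qcoeff f 0 = 1 \<and> (\<forall>m. m \<noteq> 0 \<longrightarrow> m \<notin> S \<longrightarrow> qcoeff f m = 0)}"

lemma unipotentI: "qcoeff f 0 = 1 \<Longrightarrow> (\<And>m. m \<noteq> 0 \<Longrightarrow> m \<notin> S \<Longrightarrow> qcoeff f m = 0) \<Longrightarrow> f \<in> unipotent S"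
  by (auto simp: unipotent_def)

lemma unipotentD: "f \<in> unipotent S \<Longrightarrow> qcoeff f 0 = 1" 
  "f \<in> unipotent S \<Longrightarrow> m \<noteq> 0 \<Longrightarrow> m \<notin> S \<Longrightarrow> qcoeff f m = 0"
  by (simp_all add: unipotent_def del: split_paired_All)

lemma unipotent_mult:
  assumes "f \<in> unipotent S" "g \<in> unipotent S" "\<And>x y. x \<in> S \<Longrightarrow> y \<in> S \<Longrightarrow> x + y \<in> S"
  shows "f * g \<in> unipotent S"
proof (rule unipotentI)
  show "qcoeff (f * g) 0 = 1" using assms by (simp add: qcoeff_mult_0 unipotentD)
  fix m assume m: "m \<noteq> 0" "m \<notin> S"
  have "qcoeff f x * qcoeff g y = 0" if "x + y = m" for x y
  proof (rule ccontr)
    assume *: "qcoeff f x * qcoeff g y \<noteq> 0"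
    then have "x = 0 \<or> x \<in> S" "y = 0 \<or> y \<in> S"
      using unipotentD(2)[OF assms(1), of x] unipotentD(2)[OF assms(2), of y] mult_not_zero[OF *] by metis+
    then show False using assms(3)[of x y] m that by (metis add_0 add.right_neutral)
  qed
  then show "qcoeff (f * g) m = 0"
    unfolding qcoeff_mult by (intro sum.neutral) (auto simp: splits_def)
qed

definition total_degree :: "bidegree \<Rightarrow> nat" where "total_degree m = fst m + snd m"

lemma splits_degree_less:
  "(x, y) \<in> splits m - {(m, 0)} \<Longrightarrow> total_degree x < total_degree m"
  "(x, y) \<in> splits m - {(0, m)} \<Longrightarrow> total_degree y < total_degree m"
proof -
  have *: "total_degree (x + y) = total_degree x + total_degree y" "total_degree x = 0 \<longleftrightarrow> x = 0" for x y
    by (auto simp: total_degree_def prod_eq_iff)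
  show "total_degree x < total_degree m" if "(x, y) \<in> splits m - {(m, 0)}"
  proof -
    have "m = x + y" using that by (simp add: splits_def)
    moreover have "y \<noteq> 0" using that \<open>m = x + y\<close> by (metis Diff_iff add.right_neutral singletonI)
    ultimately show ?thesis using * by (metis add.right_neutral add_strict_left_mono neq0_conv)
  qed
  show "total_degree y < total_degree m" if "(x, y) \<in> splits m - {(0, m)}"
  proof -
    have "m = x + y" using that by (simp add: splits_def)
    moreover have "x \<noteq> 0" using that \<open>m = x + y\<close> by (metis Diff_iff add_0 singletonI)
    ultimately show ?thesis using * by (metis add_0 add_strict_right_mono neq0_conv)
  qed
qed

text \<open>For \<open>F\<close> with constant term 1, the coefficient of the product at
  \<open>m\<close> is the unknown at \<open>m\<close> plus terms with unknowns of smaller total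
  degree. The recursion solves for it on \<open>S\<close> and puts 0 at the other nonzero
  bidegrees.\<close>

function left_killer :: "bidegree set \<Rightarrow> qps \<Rightarrow> bidegree \<Rightarrow> laurent fract" where
  "left_killer S F m = (if m = 0 then 1 else if m \<in> S then
     - (\<Sum>(x, y)\<in>splits m - {(m, 0)}. vf (qform x y) * left_killer S F x * qcoeff F y) else 0)"
  by auto
termination by (relation "measure (\<lambda>(S, F, m). total_degree m)") (use splits_degree_less in \<open>fastforce+\<close>)

function right_killer :: "bidegree set \<Rightarrow> qps \<Rightarrow> bidegree \<Rightarrow> laurent fract" where
  "right_killer S F m = (if m = 0 then 1 else if m \<in> S then
     - (\<Sum>(x, y)\<in>splits m - {(0, m)}. vf (qform x y) * qcoeff F x * right_killer S F y) else 0)"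
  by auto
termination by (relation "measure (\<lambda>(S, F, m). total_degree m)") (use splits_degree_less in \<open>fastforce+\<close>)

declare left_killer.simps [simp del] right_killer.simps [simp del]

lemma left_kill:
  assumes "qcoeff F 0 = 1"
  obtains C where "C \<in> unipotent S" "\<And>m. m \<noteq> 0 \<Longrightarrow> m \<in> S \<Longrightarrow> qcoeff (C * F) m = 0"
proof
  show "QPS (left_killer S F) \<in> unipotent S"
    by (rule unipotentI; subst qps.sel; subst left_killer.simps; simp)
  fix m :: bidegree assume "m \<noteq> 0" "m \<in> S"
  then show "qcoeff (QPS (left_killer S F) * F) m = 0"
    using assms by (subst qcoeff_mult_split0) (simp_all add: left_killer.simps[of S F m])
qed

lemma right_kill:
  assumes "qcoeff F 0 = 1"
  obtains D where "D \<in> unipotent S" "\<And>m. m \<noteq> 0 \<Longrightarrow> m \<in> S \<Longrightarrow> qcoeff (F * D) m = 0"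
proof
  show "QPS (right_killer S F) \<in> unipotent S"
    by (rule unipotentI; subst qps.sel; subst right_killer.simps; simp)
  fix m :: bidegree assume "m \<noteq> 0" "m \<in> S"
  then show "qcoeff (F * QPS (right_killer S F)) m = 0"
    using assms by (subst qcoeff_mult_split1) (simp_all add: right_killer.simps[of S F m])
qed

text \<open>Killing all of \<open>S\<close> in \<open>g * f\<close> leaves only the constant term,
  because \<open>g * f\<close> is again supported in \<open>S\<close> apart from that term.\<close>

lemma unipotent_left_inverse:
  assumes "f \<in> unipotent S" "\<And>x y. x \<in> S \<Longrightarrow> y \<in> S \<Longrightarrow> x + y \<in> S"
  obtains g where "g \<in> unipotent S" "g * f = 1"
proof -
  obtain g where g: "g \<in> unipotent S" "\<And>m. m \<noteq> 0 \<Longrightarrow> m \<in> S \<Longrightarrow> qcoeff (g * f) m = 0"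
    using left_kill[of f S] assms unipotentD(1) by metis
  have "g * f \<in> unipotent S" by (rule unipotent_mult) (use assms g in auto)
  then have "g * f = 1"
    by (intro qps_eqI) (auto dest: unipotentD g(2) simp: unipotentD(1))
  then show ?thesis using that g by blast
qed

lemma unipotent_inverse:
  assumes "f \<in> unipotent S" "\<And>x y. x \<in> S \<Longrightarrow> y \<in> S \<Longrightarrow> x + y \<in> S"
  obtains g where "g \<in> unipotent S" "g * f = 1" "f * g = 1"
proof -
  obtain g where g: "g \<in> unipotent S" "g * f = 1"
    using unipotent_left_inverse assms by metis
  \<comment> \<open>A left inverse of \<open>g\<close> must equal \<open>f\<close>, so
    \<open>g\<close> is a two-sided inverse.\<close>
  obtain h where "h * g = 1" using unipotent_left_inverse[OF g(1)] assms by metis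
  then have "h = f" by (metis g(2) mult.assoc mult_1 mult.right_neutral)
  then show ?thesis using that g \<open>h * g = 1\<close> by blast
qed

text \<open>Conjugation by the normalised monomial of bidegree \<open>(-a1, -a2)\<close>.\<close>

definition twist :: "int \<Rightarrow> int \<Rightarrow> qps \<Rightarrow> qps" where
  "twist a1 a2 f = QPS (\<lambda>m. vf (2 * (a1 * int (snd m) - a2 * int (fst m))) * qcoeff f m)"

lemma qcoeff_twist [simp]:
  "qcoeff (twist a1 a2 f) m = vf (2 * (a1 * int (snd m) - a2 * int (fst m))) * qcoeff f m"
  by (simp add: twist_def)

lemma twist_mult: "twist a1 a2 (f * g) = twist a1 a2 f * twist a1 a2 g"
proof (rule qps_eqI)
  fix m
  let ?w = "\<lambda>m. 2 * (a1 * int (snd m) - a2 * int (fst m))"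
  have "vf (?w m) = vf (?w x) * vf (?w y)" if "x + y = m" for x y
    unfolding vf_add[symmetric] that[symmetric] by (simp add: algebra_simps)
  then show "qcoeff (twist a1 a2 (f * g)) m = qcoeff (twist a1 a2 f * twist a1 a2 g) m"
    by (auto simp: qcoeff_mult sum_distrib_left splits_def intro!: sum.cong)
qed

lemma twist_1 [simp]: "twist a1 a2 1 = 1"
  by (rule qps_eqI) simp

lemma twist_unipotent: "f \<in> unipotent S \<Longrightarrow> twist a1 a2 f \<in> unipotent S"
  by (auto simp: unipotent_def)

text \<open>With \<open>z\<close> the monomial of bidegree \<open>(-a1, -a2)\<close>,
  \<open>twist\<close> is the map \<open>f -> z f z^(-1)\<close> and the element sought is
  \<open>G z\<close>. The two equations say that \<open>E1 (G z) E1^(-1) = x z\<close> and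
  \<open>E2^(-1) (G z) E2 = y z\<close>. Working with \<open>G\<close> keeps all exponents
  nonnegative.\<close>

lemma pointed_factorization:
  fixes a1 a2 :: int and E1 E2 :: qps and upper lower :: "bidegree set"
  assumes "qcoeff E1 0 = 1" "qcoeff E2 0 = 1"
  defines "upper \<equiv> {m. a1 * int (snd m) > a2 * int (fst m)}"
    and "lower \<equiv> {m. a1 * int (snd m) < a2 * int (fst m)}"
  obtains G x y where "qcoeff G 0 = 1" "x \<in> unipotent upper" "y \<in> unipotent lower"
    "E1 * G = x * twist a1 a2 E1" "G * twist a1 a2 E2 = E2 * y"
proof -
  let ?t = "twist a1 a2"
  have upper: "x + y \<in> upper" if "x \<in> upper" "y \<in> upper" for x y
    using that by (simp add: upper_def algebra_simps)
  have lower: "x + y \<in> lower" if "x \<in> lower" "y \<in> lower" for x y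
    using that by (simp add: lower_def algebra_simps)
  let ?F = "E1 * E2"
  obtain C where C: "C \<in> unipotent upper" "\<And>m. m \<noteq> 0 \<Longrightarrow> m \<in> upper \<Longrightarrow> qcoeff (C * ?F) m = 0"
    using left_kill[of ?F upper] assms(1,2) by (metis mult_1 qcoeff_mult_0)
  have CF: "C * ?F \<in> unipotent (- upper)"
    using C assms(1,2) by (intro unipotentI) (simp_all add: qcoeff_mult_0 unipotentD(1))
  obtain D where D: "D \<in> unipotent lower" "\<And>m. m \<noteq> 0 \<Longrightarrow> m \<in> lower \<Longrightarrow> qcoeff (C * ?F * D) m = 0"
    using right_kill[of "C * ?F" lower] unipotentD(1)[OF CF] by metis
  \<comment> \<open>Right multiplication by \<open>D\<close> must not bring back upper terms:
    \<open>lower\<close> lies in the complement of \<open>upper\<close>, which is closed under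
    addition.\<close>
  have "D \<in> unipotent (- upper)"
    using D(1) by (auto simp: unipotent_def upper_def lower_def)
  moreover have "x + y \<in> - upper" if "x \<in> - upper" "y \<in> - upper" for x y
    using that by (simp add: upper_def algebra_simps)
  ultimately have CFD: "C * ?F * D \<in> unipotent (- upper)"
    by (intro unipotent_mult[OF CF]) auto
  \<comment> \<open>Upper and lower terms are both gone, so \<open>A\<close> lives on the line,
    where \<open>twist\<close> multiplies by 1.\<close>
  define A where "A = C * ?F * D"
  have "qcoeff A m = 0" if "a1 * int (snd m) \<noteq> a2 * int (fst m)" for m
  proof -
    have "m \<noteq> 0" using that by auto
    moreover have "m \<in> upper \<or> m \<in> lower" using that by (auto simp: upper_def lower_def)
    ultimately show ?thesis
      using CFD D(2)[of m] by (auto simp: A_def dest: unipotentD(2))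
  qed
  then have "qcoeff (?t A) m = qcoeff A m" for m
    by (cases "a1 * int (snd m) = a2 * int (fst m)") simp_all
  then have tA: "?t A = A"
    by (rule qps_eqI)
  obtain C' where C': "C' \<in> unipotent upper" "C' * C = 1" "C * C' = 1"
    using unipotent_inverse[OF C(1)] upper by metis
  obtain D' where D': "D' \<in> unipotent lower" "D' * D = 1" "D * D' = 1"
    using unipotent_inverse[OF D(1)] lower by metis
  have "E1 \<in> unipotent UNIV" using assms by (simp add: unipotent_def)
  then obtain E1' where E1': "E1' \<in> unipotent UNIV" "E1' * E1 = 1" "E1 * E1' = 1"
    using unipotent_inverse[of E1 UNIV] by auto
  define G where "G = E1' * C' * ?t C * ?t E1"
  have t1: "?t D * ?t D' = 1" by (simp add: D' flip: twist_mult)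
  show ?thesis
  proof
    show "qcoeff G 0 = 1"
      by (simp add: G_def qcoeff_mult_0 unipotentD(1)[OF E1'(1)] unipotentD(1)[OF C'(1)] unipotentD(1)[OF C(1)] assms)
    show "C' * ?t C \<in> unipotent upper"
      by (intro unipotent_mult C' twist_unipotent C upper)
    show "D * ?t D' \<in> unipotent lower"
      by (intro unipotent_mult D' twist_unipotent D lower)
    have "E1 * G = (E1 * E1') * C' * ?t C * ?t E1" by (simp add: G_def mult.assoc)
    then show "E1 * G = C' * ?t C * ?t E1" by (simp add: E1')
    \<comment> \<open>Inserting \<open>?t D * ?t D' = 1\<close> completes the middle product to
      \<open>?t A\<close>, which is \<open>A\<close> itself.\<close>
    have "G * ?t E2 = E1' * C' * (?t C * ?t E1 * ?t E2 * (?t D * ?t D'))"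
      unfolding t1 by (simp add: G_def mult.assoc)
    also have "\<dots> = E1' * C' * (?t A * ?t D')"
      by (simp add: A_def twist_mult mult.assoc)
    also have "\<dots> = E1' * (C' * C) * E1 * E2 * D * ?t D'"
      unfolding tA by (simp add: A_def mult.assoc)
    also have "\<dots> = (E1' * E1) * E2 * D * ?t D'"
      unfolding C'(2) by (simp add: mult.assoc)
    finally show "G * ?t E2 = E2 * (D * ?t D')"
      unfolding E1'(2) by (simp add: mult.assoc)
  qed
qed

section \<open>From the factorization to recurrences along rows and columns\<close>

lemma qcoeff_mult_line:
  assumes "inj \<phi>" "\<And>x. x \<notin> range \<phi> \<Longrightarrow> qcoeff E x = 0"
    and split: "\<And>k. k \<le> p \<Longrightarrow> \<phi> k + \<psi> k = m" "\<And>k y. \<phi> k + y = m \<Longrightarrow> k \<le> p"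
  shows "qcoeff (E * F) m = (\<Sum>k\<le>p. vf (qform (\<phi> k) (\<psi> k)) * qcoeff E (\<phi> k) * qcoeff F (\<psi> k))"
    and "qcoeff (F * E) m = (\<Sum>k\<le>p. vf (qform (\<psi> k) (\<phi> k)) * qcoeff F (\<psi> k) * qcoeff E (\<phi> k))"
proof -
  \<comment> \<open>A support point of \<open>E\<close> is some \<open>\<phi> k\<close>, and its
    partner is then forced to be \<open>\<psi> k\<close>; so the splittings that count are indexed
    by \<open>k \<le> p\<close>.\<close>
  have mem: "z \<in> (\<lambda>k. (\<phi> k, \<psi> k)) ` {..p}" if "fst z + snd z = m" "qcoeff E (fst z) \<noteq> 0" for z
  proof -
    have "fst z \<in> range \<phi>" using assms(2)[of "fst z"] that(2) by argo
    then obtain k where k: "fst z = \<phi> k" by blast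
    then have "k \<le> p" using split(2)[of k "snd z"] that by simp
    then have "snd z = \<psi> k" using split(1)[of k] that(1) k add_left_cancel[of "\<phi> k" "snd z" "\<psi> k"] by simp
    then show ?thesis using k \<open>k \<le> p\<close> by (intro image_eqI[of _ _ k]) (simp_all add: prod_eq_iff)
  qed
  have "qcoeff (E * F) m = (\<Sum>z\<in>splits m. vf (qform (fst z) (snd z)) * qcoeff E (fst z) * qcoeff F (snd z))"
    by (simp add: qcoeff_mult split_def)
  also have "\<dots> = (\<Sum>z\<in>(\<lambda>k. (\<phi> k, \<psi> k)) ` {..p}. vf (qform (fst z) (snd z)) * qcoeff E (fst z) * qcoeff F (snd z))"
  proof (rule sum.mono_neutral_right)
    show "\<forall>z\<in>splits m - (\<lambda>k. (\<phi> k, \<psi> k)) ` {..p}. vf (qform (fst z) (snd z)) * qcoeff E (fst z) * qcoeff F (snd z) = 0"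
    proof
      fix z assume z: "z \<in> splits m - (\<lambda>k. (\<phi> k, \<psi> k)) ` {..p}"
      then have "fst z + snd z = m" by (auto simp: splits_def)
      then have "qcoeff E (fst z) = 0" using mem[of z] z by blast
      then show "vf (qform (fst z) (snd z)) * qcoeff E (fst z) * qcoeff F (snd z) = 0" by simp
    qed
  qed (simp, use split in \<open>auto simp: splits_def\<close>)
  also have "\<dots> = (\<Sum>k\<le>p. vf (qform (\<phi> k) (\<psi> k)) * qcoeff E (\<phi> k) * qcoeff F (\<psi> k))"
    by (subst sum.reindex) (use assms(1) in \<open>auto simp: inj_def inj_on_def\<close>)
  finally show "qcoeff (E * F) m = \<dots>" .
  have mem: "z \<in> (\<lambda>k. (\<psi> k, \<phi> k)) ` {..p}" if "fst z + snd z = m" "qcoeff E (snd z) \<noteq> 0" for z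
    using mem[of "(snd z, fst z)"] that by (cases z) (auto simp: add.commute)
  have "qcoeff (F * E) m = (\<Sum>z\<in>splits m. vf (qform (fst z) (snd z)) * qcoeff F (fst z) * qcoeff E (snd z))"
    by (simp add: qcoeff_mult split_def)
  also have "\<dots> = (\<Sum>z\<in>(\<lambda>k. (\<psi> k, \<phi> k)) ` {..p}. vf (qform (fst z) (snd z)) * qcoeff F (fst z) * qcoeff E (snd z))"
  proof (rule sum.mono_neutral_right)
    show "\<forall>z\<in>splits m - (\<lambda>k. (\<psi> k, \<phi> k)) ` {..p}. vf (qform (fst z) (snd z)) * qcoeff F (fst z) * qcoeff E (snd z) = 0"
    proof
      fix z assume z: "z \<in> splits m - (\<lambda>k. (\<psi> k, \<phi> k)) ` {..p}"
      then have "fst z + snd z = m" by (auto simp: splits_def)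
      then have "qcoeff E (snd z) = 0" using mem[of z] z by blast
      then show "vf (qform (fst z) (snd z)) * qcoeff F (fst z) * qcoeff E (snd z) = 0" by simp
    qed
  qed (simp, use split in \<open>auto simp: splits_def add.commute\<close>)
  also have "\<dots> = (\<Sum>k\<le>p. vf (qform (\<psi> k) (\<phi> k)) * qcoeff F (\<psi> k) * qcoeff E (\<phi> k))"
    by (subst sum.reindex) (use assms(1) in \<open>auto simp: inj_def inj_on_def\<close>)
  finally show "qcoeff (F * E) m = \<dots>" .
qed

text \<open>By \<open>dilog_Bser\<close> the two dilogarithms differ by the factor
  \<open>Bser b n\<close>; the common one is a nonzero series over a field and cancels.\<close>

lemma dilog_cancel:
  assumes "b \<noteq> 0"
    and "fscale (vf (int n * b)) (dilog b) * e = fscale (vf (- (int n * b))) (dilog b) * f"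
  shows "e * tofps (Hser b n) = f"
proof -
  let ?E = "fscale (vf (int n * b)) (dilog b)"
  have "fps_nth ?E 0 = 1" by (simp add: dilog_def)
  then have "?E \<noteq> 0" by (metis fps_zero_nth zero_neq_one)
  moreover have "?E * e = ?E * (tofps (Bser b n) * f)"
    using assms(2) by (simp add: mult.assoc flip: dilog_Bser[OF assms(1)])
  ultimately have "e = tofps (Bser b n) * f" by simp
  then have "e * tofps (Hser b n) = tofps (Bser b n) * tofps (Hser b n) * f" by simp
  then show ?thesis by (simp add: tofps_Bser_Hser)
qed

lemma mult_regroup:
  fixes x y u t d g :: "'a::comm_ring_1"
  shows "x * y = u * t \<Longrightarrow> x * (y * d * g) = u * d * (t * g)"
    and "x * y * r = u * t \<Longrightarrow> x * (y * g * (r * d)) = u * d * (t * g)"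
proof -
  have 1: "x * (y * d * g) = x * y * (d * g)" "x * (y * g * (r * d)) = x * y * r * (d * g)"
    by (simp_all only: mult_ac)
  show "x * y = u * t \<Longrightarrow> x * (y * d * g) = u * d * (t * g)"
    "x * y * r = u * t \<Longrightarrow> x * (y * g * (r * d)) = u * d * (t * g)"
    unfolding 1 by (simp_all add: mult_ac)
qed

text \<open>\<open>pointed_factorization\<close> for the dilogarithms of \<open>X_1^b\<close> and
  \<open>X_2^c\<close>, read off one row or column at a time. Rows are restricted to
  \<open>c q \<le> a2\<close> and columns to \<open>b p \<le> a1\<close>, where the truncations
  change nothing.\<close>

lemma pointed_recurrences:
  fixes b c :: nat and a1 a2 :: int
  assumes b: "b > 0" and c: "c > 0"
  obtains g :: "nat \<Rightarrow> nat \<Rightarrow> laurent fract" where "g 0 0 = 1"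
    "\<And>p q. (p, q) \<noteq> (0, 0) \<Longrightarrow> int c * int q \<le> a2 \<Longrightarrow> int c * a1 * int q \<le> int b * a2 * int p \<Longrightarrow>
       fps_nth (Abs_fps (\<lambda>i. g i q) * tofps (Hser (int b) (nat (a2 - int c * int q)))) p = 0"
    "\<And>p q. (p, q) \<noteq> (0, 0) \<Longrightarrow> int b * int p \<le> a1 \<Longrightarrow> int c * a1 * int q \<ge> int b * a2 * int p \<Longrightarrow>
       fps_nth (Abs_fps (\<lambda>j. g p j) * tofps (Hser (int c) (nat (a1 - int b * int p)))) q = 0"
proof -
  define E1 where "E1 = QPS (\<lambda>(P, Q). if Q = 0 \<and> b dvd P then dilog_coeff (int b) (P div b) else 0)"
  define E2 where "E2 = QPS (\<lambda>(P, Q). if P = 0 \<and> c dvd Q then dilog_coeff (int c) (Q div c) else 0)"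
  let ?t = "twist a1 a2"
  have E1_line: "qcoeff E1 (b * k, 0) = dilog_coeff (int b) k" for k using b by (simp add: E1_def)
  have E2_line: "qcoeff E2 (0, c * k) = dilog_coeff (int c) k" for k using c by (simp add: E2_def)
  have E1_0: "qcoeff E1 x = 0" "qcoeff (?t E1) x = 0" if "x \<notin> range (\<lambda>k. (b * k, 0))" for x
  proof -
    have "\<not> (snd x = 0 \<and> b dvd fst x)"
    proof
      assume "snd x = 0 \<and> b dvd fst x"
      then obtain k where "x = (b * k, 0)" by (metis dvdE prod.collapse)
      then show False using that by blast
    qed
    then show "qcoeff E1 x = 0" by (auto simp: E1_def split_def simp del: split_paired_All)
    then show "qcoeff (?t E1) x = 0" by (simp del: split_paired_All)
  qed
  have E2_0: "qcoeff E2 x = 0" "qcoeff (?t E2) x = 0" if "x \<notin> range (\<lambda>k. (0, c * k))" for x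
  proof -
    have "\<not> (fst x = 0 \<and> c dvd snd x)"
    proof
      assume "fst x = 0 \<and> c dvd snd x"
      then obtain k where "x = (0, c * k)" by (metis dvdE prod.collapse)
      then show False using that by blast
    qed
    then show "qcoeff E2 x = 0" by (auto simp: E2_def split_def simp del: split_paired_All)
    then show "qcoeff (?t E2) x = 0" by (simp del: split_paired_All)
  qed
  have unit: "qcoeff E1 0 = 1" "qcoeff E2 0 = 1"
    using E1_line[of 0] E2_line[of 0] by (simp_all add: zero_prod_def)
  obtain G x y where G: "qcoeff G 0 = 1"
    "x \<in> unipotent {m. a1 * int (snd m) > a2 * int (fst m)}"
    "y \<in> unipotent {m. a1 * int (snd m) < a2 * int (fst m)}"
    "E1 * G = x * ?t E1" "G * ?t E2 = E2 * y"
    by (rule pointed_factorization[OF unit])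
  have inj: "inj (\<lambda>k. (b * k, 0::nat))" "inj (\<lambda>k. (0::nat, c * k))"
    using b c by (auto simp: inj_def)
  \<comment> \<open>\<open>\<theta> P Q\<close> is the exponent of \<open>v\<close> in the product
    of the normalised monomials of bidegrees \<open>(P, Q)\<close> and \<open>(-a1, -a2)\<close>, so
    \<open>g\<close> lists coefficients of \<open>G z\<close>.\<close>
  define \<theta> where "\<theta> = (\<lambda>P Q. a2 * int P - a1 * int Q)"
  define g where "g = (\<lambda>p q. vf (\<theta> (b * p) (c * q)) * qcoeff G (b * p, c * q))"
  show ?thesis
  proof (rule that[of g])
    show "g 0 0 = 1" using G(1) by (simp add: g_def \<theta>_def zero_prod_def)
  next
    fix p q assume pq: "(p, q) \<noteq> (0::nat, 0::nat)" "int c * int q \<le> a2" "int c * a1 * int q \<le> int b * a2 * int p"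
    define n where "n = nat (a2 - int c * int q)"
    define f where "f = Abs_fps (\<lambda>p. vf (\<theta> (b * p) (c * q)) * qcoeff x (b * p, c * q))"
    \<comment> \<open>In terms of \<open>g\<close>, row \<open>q\<close> of
      \<open>E1 * G = x * ?t E1\<close> is an identity of series in one variable: each
      \<open>X_1^b\<close> contributes \<open>v^(n b)\<close> on the left and
      \<open>v^(-n b)\<close> on the right.\<close>
    have "fscale (vf (int n * int b)) (dilog (int b)) * Abs_fps (\<lambda>i. g i q) = fscale (vf (- (int n * int b))) (dilog (int b)) * f"
    proof (rule fps_ext)
      fix p
      let ?\<psi> = "\<lambda>k. (b * (p - k), c * q)"
      have splitting: "(b * k, 0) + ?\<psi> k = (b * p, c * q)" if "k \<le> p" for k
        using that by (simp flip: add_mult_distrib2)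
      have splitting': "k \<le> p" if "(b * k, 0) + y = (b * p, c * q)" for k y
      proof -
        have "b * k + fst y = b * p" using that by (cases y) simp
        then have "b * k \<le> b * p" by linarith
        then show ?thesis using b by simp
      qed
      have n: "int n = a2 - int c * int q" using pq by (simp add: n_def)
      have L: "vf (\<theta> (b * p) (c * q)) * (vf (qform (b * k, 0) (?\<psi> k)) * qcoeff E1 (b * k, 0) * qcoeff G (?\<psi> k)) =
          vf (int n * int b) ^ k * dilog_coeff (int b) k * g (p - k) q" if "k \<in> {..p}" for k
      proof -
        have "vf (\<theta> (b * p) (c * q)) * vf (qform (b * k, 0) (?\<psi> k)) =
            vf (int n * int b) ^ k * vf (\<theta> (b * (p - k)) (c * q))"
          unfolding vf_power vf_add[symmetric] using that
          by (simp add: \<theta>_def qform.simps n of_nat_diff algebra_simps)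
        then show ?thesis unfolding g_def E1_line by (rule mult_regroup)
      qed
      have R: "vf (\<theta> (b * p) (c * q)) * (vf (qform (?\<psi> k) (b * k, 0)) * qcoeff x (?\<psi> k) * qcoeff (?t E1) (b * k, 0)) =
          vf (- (int n * int b)) ^ k * dilog_coeff (int b) k * fps_nth f (p - k)" if "k \<in> {..p}" for k
      proof -
        have "vf (\<theta> (b * p) (c * q)) * vf (qform (?\<psi> k) (b * k, 0)) * vf (2 * (a1 * int 0 - a2 * int (b * k))) =
            vf (- (int n * int b)) ^ k * vf (\<theta> (b * (p - k)) (c * q))"
          unfolding vf_power vf_add[symmetric] using that
          by (simp add: \<theta>_def qform.simps n of_nat_diff algebra_simps)
        then show ?thesis unfolding f_def fps_nth_Abs_fps qcoeff_twist E1_line fst_conv snd_conv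
          by (rule mult_regroup)
      qed
      have "(\<Sum>k\<le>p. vf (qform (b * k, 0) (?\<psi> k)) * qcoeff E1 (b * k, 0) * qcoeff G (?\<psi> k)) =
          (\<Sum>k\<le>p. vf (qform (?\<psi> k) (b * k, 0)) * qcoeff x (?\<psi> k) * qcoeff (?t E1) (b * k, 0))"
        using qcoeff_mult_line(1)[of "\<lambda>k. (b * k, 0)" E1 p ?\<psi> "(b * p, c * q)" G, OF inj(1) E1_0(1) splitting splitting']
          qcoeff_mult_line(2)[of "\<lambda>k. (b * k, 0)" "?t E1" p ?\<psi> "(b * p, c * q)" x, OF inj(1) E1_0(2) splitting splitting'] G(4)
        by simp
      from arg_cong[OF this, of "\<lambda>s. vf (\<theta> (b * p) (c * q)) * s"]
      have "(\<Sum>k\<le>p. vf (int n * int b) ^ k * dilog_coeff (int b) k * g (p - k) q) = (\<Sum>k\<le>p. vf (- (int n * int b)) ^ k * dilog_coeff (int b) k * fps_nth f (p - k))"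
        unfolding sum_distrib_left by (simp only: sum.cong[OF refl L] sum.cong[OF refl R])
      then show "fps_nth (fscale (vf (int n * int b)) (dilog (int b)) * Abs_fps (\<lambda>i. g i q)) p =
          fps_nth (fscale (vf (- (int n * int b))) (dilog (int b)) * f) p"
        by (simp add: fps_mult_nth atLeast0AtMost dilog_def)
    qed
    from dilog_cancel[OF _ this] have "Abs_fps (\<lambda>i. g i q) * tofps (Hser (int b) n) = f" using b by simp
    \<comment> \<open>The hypothesis puts this nonzero bidegree outside the open half plane that
      carries \<open>x - 1\<close>.\<close>
    moreover have "qcoeff x (b * p, c * q) = 0"
      using pq b c by (intro unipotentD(2)[OF G(2)]) (auto simp: zero_prod_def algebra_simps)
    ultimately show "fps_nth (Abs_fps (\<lambda>i. g i q) * tofps (Hser (int b) (nat (a2 - int c * int q)))) p = 0"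
      by (simp add: n_def f_def)
  next
    fix p q assume pq: "(p, q) \<noteq> (0::nat, 0::nat)" "int b * int p \<le> a1" "int c * a1 * int q \<ge> int b * a2 * int p"
    define n where "n = nat (a1 - int b * int p)"
    define f where "f = Abs_fps (\<lambda>q. vf (\<theta> (b * p) (c * q)) * qcoeff y (b * p, c * q))"
    \<comment> \<open>Columns use \<open>G * ?t E2 = E2 * y\<close>; here the twist sits on the side
      of \<open>G\<close>, which again yields the exponent \<open>n\<close> for \<open>g\<close> and
      \<open>-n\<close> for \<open>y\<close>.\<close>
    have "fscale (vf (int n * int c)) (dilog (int c)) * Abs_fps (\<lambda>j. g p j) = fscale (vf (- (int n * int c))) (dilog (int c)) * f"
    proof (rule fps_ext)
      fix q
      let ?\<psi> = "\<lambda>k. (b * p, c * (q - k))"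
      have splitting: "(0, c * k) + ?\<psi> k = (b * p, c * q)" if "k \<le> q" for k
        using that by (simp flip: add_mult_distrib2)
      have splitting': "k \<le> q" if "(0, c * k) + y = (b * p, c * q)" for k y
      proof -
        have "c * k + snd y = c * q" using that by (cases y) simp
        then have "c * k \<le> c * q" by linarith
        then show ?thesis using c by simp
      qed
      have n: "int n = a1 - int b * int p" using pq by (simp add: n_def)
      have L: "vf (\<theta> (b * p) (c * q)) * (vf (qform (?\<psi> k) (0, c * k)) * qcoeff G (?\<psi> k) * qcoeff (?t E2) (0, c * k)) =
          vf (int n * int c) ^ k * dilog_coeff (int c) k * g p (q - k)" if "k \<in> {..q}" for k
      proof -
        have "vf (\<theta> (b * p) (c * q)) * vf (qform (?\<psi> k) (0, c * k)) * vf (2 * (a1 * int (c * k) - a2 * int 0)) =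
            vf (int n * int c) ^ k * vf (\<theta> (b * p) (c * (q - k)))"
          unfolding vf_power vf_add[symmetric] using that
          by (simp add: \<theta>_def qform.simps n of_nat_diff algebra_simps)
        then show ?thesis unfolding g_def qcoeff_twist E2_line fst_conv snd_conv by (rule mult_regroup)
      qed
      have R: "vf (\<theta> (b * p) (c * q)) * (vf (qform (0, c * k) (?\<psi> k)) * qcoeff E2 (0, c * k) * qcoeff y (?\<psi> k)) =
          vf (- (int n * int c)) ^ k * dilog_coeff (int c) k * fps_nth f (q - k)" if "k \<in> {..q}" for k
      proof -
        have "vf (\<theta> (b * p) (c * q)) * vf (qform (0, c * k) (?\<psi> k)) =
            vf (- (int n * int c)) ^ k * vf (\<theta> (b * p) (c * (q - k)))"
          unfolding vf_power vf_add[symmetric] using that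
          by (simp add: \<theta>_def qform.simps n of_nat_diff algebra_simps)
        then show ?thesis unfolding f_def fps_nth_Abs_fps E2_line by (rule mult_regroup)
      qed
      have "(\<Sum>k\<le>q. vf (qform (?\<psi> k) (0, c * k)) * qcoeff G (?\<psi> k) * qcoeff (?t E2) (0, c * k)) =
          (\<Sum>k\<le>q. vf (qform (0, c * k) (?\<psi> k)) * qcoeff E2 (0, c * k) * qcoeff y (?\<psi> k))"
        using qcoeff_mult_line(1)[of "\<lambda>k. (0, c * k)" E2 q ?\<psi> "(b * p, c * q)" y, OF inj(2) E2_0(1) splitting splitting']
          qcoeff_mult_line(2)[of "\<lambda>k. (0, c * k)" "?t E2" q ?\<psi> "(b * p, c * q)" G, OF inj(2) E2_0(2) splitting splitting'] G(5)
        by simp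
      from arg_cong[OF this, of "\<lambda>s. vf (\<theta> (b * p) (c * q)) * s"]
      have "(\<Sum>k\<le>q. vf (int n * int c) ^ k * dilog_coeff (int c) k * g p (q - k)) = (\<Sum>k\<le>q. vf (- (int n * int c)) ^ k * dilog_coeff (int c) k * fps_nth f (q - k))"
        unfolding sum_distrib_left by (simp only: sum.cong[OF refl L] sum.cong[OF refl R])
      then show "fps_nth (fscale (vf (int n * int c)) (dilog (int c)) * Abs_fps (\<lambda>j. g p j)) q =
          fps_nth (fscale (vf (- (int n * int c))) (dilog (int c)) * f) q"
        by (simp add: fps_mult_nth atLeast0AtMost dilog_def)
    qed
    from dilog_cancel[OF _ this] have "Abs_fps (\<lambda>j. g p j) * tofps (Hser (int c) n) = f" using c by simp
    moreover have "qcoeff y (b * p, c * q) = 0"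
      using pq b c by (intro unipotentD(2)[OF G(3)]) (auto simp: zero_prod_def algebra_simps)
    ultimately show "fps_nth (Abs_fps (\<lambda>j. g p j) * tofps (Hser (int c) (nat (a1 - int b * int p)))) q = 0"
      by (simp add: n_def f_def)
  qed
qed

section \<open>The quantum torus as a module over the scalars\<close>

abbreviation mon :: "int \<Rightarrow> int \<Rightarrow> qtorus" where
  "mon \<equiv> torus_monomial"

lemma poly_mapping_additive_induct:
  assumes "P 0" "\<And>k v. P (Poly_Mapping.single k v)" "\<And>x y. P x \<Longrightarrow> P y \<Longrightarrow> P (x + y)"
  shows "P (x :: 'a \<Rightarrow>\<^sub>0 int)"
proof -
  have "P (\<Sum>k\<in>A. Poly_Mapping.single k (Poly_Mapping.lookup x k))" if "finite A" for A
    using that by (induction A) (simp_all add: assms)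
  moreover have "x = (\<Sum>k\<in>Poly_Mapping.keys x. Poly_Mapping.single k (Poly_Mapping.lookup x k))"
  proof (rule poly_mapping_eqI)
    fix k
    show "Poly_Mapping.lookup x k = Poly_Mapping.lookup (\<Sum>k\<in>Poly_Mapping.keys x. Poly_Mapping.single k (Poly_Mapping.lookup x k)) k"
      unfolding lookup_sum lookup_single when_def by (simp add: in_keys_iff)
  qed
  ultimately show ?thesis by (metis finite_keys)
qed

lemma of_int_tv: "of_int n * tv i = Poly_Mapping.single (Heis i 0 0) n"
  unfolding tv_def single_of_int[symmetric] by (simp add: mult_single)

lemma torus_scalar_eq: "torus_scalar r = (\<Sum>i\<in>Poly_Mapping.keys r. Poly_Mapping.single (Heis i 0 0) (Poly_Mapping.lookup r i))"
  by (simp add: torus_scalar_def of_int_tv)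

lemma lookup_torus_scalar:
  "Poly_Mapping.lookup (torus_scalar r) (Heis s i j) = (if i = 0 \<and> j = 0 then Poly_Mapping.lookup r s else 0)"
proof -
  have "Poly_Mapping.lookup (torus_scalar r) (Heis s i j) =
      (\<Sum>k\<in>Poly_Mapping.keys r. if k = s then (if i = 0 \<and> j = 0 then Poly_Mapping.lookup r s else 0) else 0)"
    unfolding torus_scalar_eq lookup_sum by (auto simp: lookup_single when_def intro!: sum.cong)
  then show ?thesis by (simp add: in_keys_iff)
qed

lemma torus_scalar_add: "torus_scalar (r + s) = torus_scalar r + torus_scalar s"
proof (rule poly_mapping_eqI)
  fix h show "Poly_Mapping.lookup (torus_scalar (r + s)) h = Poly_Mapping.lookup (torus_scalar r + torus_scalar s) h"
    by (cases h) (simp add: lookup_torus_scalar lookup_add)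
qed

lemma torus_scalar_0 [simp]: "torus_scalar 0 = 0"
  by (simp add: torus_scalar_def)

lemma torus_scalar_single: "torus_scalar (Poly_Mapping.single i n) = Poly_Mapping.single (Heis i 0 0) n"
  by (cases "n = 0") (simp_all add: torus_scalar_eq)

lemma torus_scalar_mult: "torus_scalar (r * s) = torus_scalar r * torus_scalar s"
proof (induction r rule: poly_mapping_additive_induct)
  case (2 i n)
  show ?case
    by (induction s rule: poly_mapping_additive_induct)
      (simp_all add: torus_scalar_single mult_single torus_scalar_add algebra_simps)
qed (simp_all add: torus_scalar_add algebra_simps)

lemma torus_scalar_vpow: "torus_scalar (vpow i) = tv i"
  by (simp add: vpow_def tv_def torus_scalar_single)

lemma torus_scalar_1 [simp]: "torus_scalar 1 = 1"
  using torus_scalar_vpow[of 0] by (simp add: tv_0)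

lemma torus_scalar_uminus: "torus_scalar (- r) = - torus_scalar r"
  using torus_scalar_add[of r "- r"] by (simp add: eq_neg_iff_add_eq_0 add.commute)

lemma torus_scalar_commute: "torus_scalar r * x = x * torus_scalar r"
proof (induction r rule: poly_mapping_additive_induct)
  case (2 i n)
  show ?case
  proof (induction x rule: poly_mapping_additive_induct)
    case (2 h m)
    show ?case by (cases h) (simp add: torus_scalar_single mult_single mult.commute add.commute)
  qed (simp_all add: algebra_simps)
qed (simp_all add: torus_scalar_add algebra_simps)

lemma mon_single: "mon i j = Poly_Mapping.single (Heis (i * j) i j) 1"
  by (simp add: torus_monomial_def single_Heis)

lemma mon_mult: "mon i j * mon i' j' = torus_scalar (vpow (j * i' - i * j')) * mon (i + i') (j + j')"
  by (simp add: mon_single torus_scalar_vpow tv_def mult_single algebra_simps)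

lemma mon_0 [simp]: "mon 0 0 = 1"
  by (simp add: torus_monomial_def tv_0 tX1_0 tX2_0)

text \<open>The shift by \<open>i * j\<close> is the power of \<open>v\<close> contained in
  \<open>mon i j\<close>, so this is the Laurent coefficient in the normalised basis.\<close>

definition mcoeff :: "int \<Rightarrow> int \<Rightarrow> qtorus \<Rightarrow> laurent" where
  "mcoeff i j x = Poly_Mapping.map_key (\<lambda>s. Heis (s + i * j) i j) x"

lemma inj_Heis: "inj (\<lambda>s. Heis (s + i * j) i j)"
  by (auto simp: inj_def)

lemma mcoeff_add: "mcoeff i j (x + y) = mcoeff i j x + mcoeff i j y"
  by (simp add: mcoeff_def map_key_plus inj_Heis)

lemma mcoeff_0 [simp]: "mcoeff i j 0 = 0"
  by (simp add: mcoeff_def map_key_zero inj_Heis)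

lemma lookup_mcoeff: "Poly_Mapping.lookup (mcoeff i j x) s = Poly_Mapping.lookup x (Heis (s + i * j) i j)"
  by (simp add: mcoeff_def map_key.rep_eq inj_Heis)

lemma mcoeff_scalar_mon: "mcoeff i j (torus_scalar r * mon i' j') = (if i = i' \<and> j = j' then r else 0)"
proof (induction r rule: poly_mapping_additive_induct)
  case (2 k n)
  show ?case
    by (rule poly_mapping_eqI)
      (auto simp: torus_scalar_single mon_single mult_single lookup_mcoeff lookup_single when_def)
qed (simp_all add: torus_scalar_add algebra_simps mcoeff_add)

lemma mcoeff_scalar: "mcoeff i j (torus_scalar r * x) = r * mcoeff i j x"
proof (induction x rule: poly_mapping_additive_induct)
  case (2 h m)
  obtain s i' j' where h: "h = Heis s i' j'" by (cases h)
  have "Poly_Mapping.single h m = torus_scalar (Poly_Mapping.single (s - i' * j') m) * mon i' j'"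
    by (simp add: h torus_scalar_single mon_single mult_single)
  then show ?case
    by (simp add: mcoeff_scalar_mon flip: mult.assoc torus_scalar_mult)
qed (simp_all add: mcoeff_add distrib_left)

lemma mcoeff_sum: "mcoeff i j (\<Sum>k\<in>A. f k) = (\<Sum>k\<in>A. mcoeff i j (f k))"
  by (induction A rule: infinite_finite_induct) (simp_all add: mcoeff_add)

lemma mcoeff_mon: "mcoeff i j (mon i' j') = (if i = i' \<and> j = j' then 1 else 0)"
  using mcoeff_scalar_mon[of i j 1] by simp

section \<open>Spans over the Laurent scalars\<close>

inductive_set tspan :: "qtorus set \<Rightarrow> qtorus set" for S where
  zero: "0 \<in> tspan S"
| add: "x \<in> S \<Longrightarrow> y \<in> tspan S \<Longrightarrow> torus_scalar r * x + y \<in> tspan S"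

lemma tspan_base: "x \<in> S \<Longrightarrow> x \<in> tspan S"
  using tspan.add[OF _ tspan.zero, of x S 1] by simp

lemma tspan_add: "x \<in> tspan S \<Longrightarrow> y \<in> tspan S \<Longrightarrow> x + y \<in> tspan S"
  by (induction rule: tspan.induct) (simp_all add: add.assoc tspan.add)

lemma tspan_scalar: "x \<in> tspan S \<Longrightarrow> torus_scalar r * x \<in> tspan S"
proof (induction rule: tspan.induct)
  case (add x y s)
  then show ?case
    using tspan.add[of x S "torus_scalar r * y" "r * s"]
    by (simp add: distrib_left torus_scalar_mult mult.assoc)
qed (simp add: tspan.zero)

lemma tspan_uminus: "x \<in> tspan S \<Longrightarrow> - x \<in> tspan S"
  using tspan_scalar[of x S "- 1"] by (simp add: torus_scalar_uminus)

lemma tspan_diff: "x \<in> tspan S \<Longrightarrow> y \<in> tspan S \<Longrightarrow> x - y \<in> tspan S"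
  using tspan_add[of x S "- y"] tspan_uminus[of y S] by simp

lemma tspan_sum: "(\<And>i. i \<in> A \<Longrightarrow> f i \<in> tspan S) \<Longrightarrow> (\<Sum>i\<in>A. f i) \<in> tspan S"
  by (induction A rule: infinite_finite_induct) (simp_all add: tspan.zero tspan_add)

lemma tspan_map:
  assumes "x \<in> tspan S"
    and "\<And>x y. f (x + y) = f x + f y" "\<And>r x. f (torus_scalar r * x) = torus_scalar r * f x"
    and "\<And>x. x \<in> S \<Longrightarrow> f x \<in> tspan S'"
  shows "f x \<in> tspan S'"
  using assms(1)
proof (induction rule: tspan.induct)
  case zero
  show ?case using assms(2)[of 0 0] by (simp add: tspan.zero)
next
  case (add x y r)
  then show ?case using assms by (simp add: tspan_add tspan_scalar)
qed

lemma tspan_mult_left: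
  assumes "x \<in> tspan S" "\<And>x. x \<in> S \<Longrightarrow> g * x \<in> tspan S'"
  shows "g * x \<in> tspan S'"
  by (rule tspan_map[OF assms(1)])
    (simp_all add: assms distrib_left torus_scalar_commute[of _ g] flip: mult.assoc)

lemma tspan_mono: "x \<in> tspan S \<Longrightarrow> S \<subseteq> S' \<Longrightarrow> x \<in> tspan S'"
  by (induction rule: tspan.induct) (auto intro: tspan.intros)

section \<open>Membership in the quantum cluster algebra\<close>

lemma scalar_mult_assoc [simp]:
  "torus_scalar r * (torus_scalar s * x) = torus_scalar (r * s) * x"
  by (simp add: torus_scalar_mult mult.assoc)

lemma scalar_left_commute: "x * (torus_scalar r * y) = torus_scalar r * (x * y)"
  by (metis mult.assoc torus_scalar_commute)

lemmas mon_scalar = scalar_left_commute[of "mon i j" for i j] scalar_left_commute[of "mon i j * y" for i j y]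

text \<open>
  Up to a power of \<open>v\<close>, \<open>rowel b i j\<close> is \<open>X\<^sub>1\<^sup>i X\<^sub>0^(-j)\<close> for \<open>j \<le> 0\<close> and \<open>colel c i j\<close> is \<open>X\<^sub>2\<^sup>j X\<^sub>3^(-i)\<close> for \<open>i \<le> 0\<close>;
  for positive \<open>j\<close>, respectively \<open>i\<close>, they are the plain monomials.
\<close>

definition rowel :: "nat \<Rightarrow> int \<Rightarrow> int \<Rightarrow> qtorus" where
  "rowel b i j = (\<Sum>k\<le>nat (- j). torus_scalar (lbin (int b) (nat (- j)) k) * mon (i + int b * int k) j)"

definition colel :: "nat \<Rightarrow> int \<Rightarrow> int \<Rightarrow> qtorus" where
  "colel c i j = (\<Sum>k\<le>nat (- i). torus_scalar (lbin (int c) (nat (- i)) k) * mon i (j + int c * int k))"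

definition X0 :: "nat \<Rightarrow> qtorus" where "X0 b = mon 0 (- 1) + mon (int b) (- 1)"
definition X3 :: "nat \<Rightarrow> qtorus" where "X3 c = mon (- 1) 0 + mon (- 1) (int c)"

text \<open>The Pascal rule summed against arbitrary terms: one more binomial factor distributes
  each term over the positions \<open>k\<close> and \<open>k + 1\<close>. Rows and columns both rest
  on it.\<close>

lemma lbin_sum_Suc:
  "(\<Sum>k\<le>Suc n. torus_scalar (lbin b (Suc n) k) * M k) =
   (\<Sum>k\<le>n. torus_scalar (lbin b n k) *
      (torus_scalar (vpow (b * int k)) * M k + torus_scalar (vpow (b * (int k - int n))) * M (Suc k)))"
proof -
  let ?P = "\<lambda>k. torus_scalar (lbin b n k) * (torus_scalar (vpow (b * int k)) * M k)"
  let ?Q = "\<lambda>k. torus_scalar (lbin b n k) * (torus_scalar (vpow (b * (int k - int n))) * M (Suc k))"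
  have "(\<Sum>k\<le>n. ?P k) = (\<Sum>k\<le>Suc n. ?P k)"
    by (simp add: lbin_eq_0)
  also have "\<dots> = M 0 + (\<Sum>k\<le>n. ?P (Suc k))"
    by (subst sum.atMost_Suc_shift) simp
  finally have "(\<Sum>k\<le>n. ?P k + ?Q k) = M 0 + (\<Sum>k\<le>n. ?P (Suc k) + ?Q k)"
    by (simp add: sum.distrib add.assoc)
  also have "\<dots> = (\<Sum>k\<le>Suc n. torus_scalar (lbin b (Suc n) k) * M k)"
    by (subst sum.atMost_Suc_shift)
      (simp add: torus_scalar_add distrib_right mult.commute add.commute)
  finally show ?thesis by (simp add: distrib_left)
qed

lemma rowel_nonneg: "j \<ge> 0 \<Longrightarrow> rowel b i j = mon i j"
  by (simp add: rowel_def)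

lemma colel_nonneg: "i \<ge> 0 \<Longrightarrow> colel c i j = mon i j"
  by (simp add: colel_def)

text \<open>Each monomial times the two terms of \<open>X0\<close> gives neighbouring monomials with
  the weights of \<open>lbin_sum_Suc\<close>, so for \<open>j \<le> 0\<close> the product grows by
  one factor.\<close>

lemma rowel_X0:
  assumes "j \<le> 0"
  shows "rowel b i j * X0 b = torus_scalar (vpow i) * rowel b i (j - 1)"
proof -
  define n where "n = nat (- j)"
  have n: "nat (- (j - 1)) = Suc n" "int n = - j" "nat (- j) = n" using assms by (auto simp: n_def)
  have *: "mon (i + int b * int k) j * X0 b = torus_scalar (vpow i) * (torus_scalar (vpow (int b * int k)) * mon (i + int b * int k) (j - 1) +
        torus_scalar (vpow (int b * (int k - int n))) * mon (i + int b * int (Suc k)) (j - 1))" for k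
    by (simp add: X0_def distrib_left mon_mult n(2) flip: vpow_add) (simp add: algebra_simps)
  have "rowel b i j * X0 b = (\<Sum>k\<le>n. torus_scalar (lbin (int b) n k) * (mon (i + int b * int k) j * X0 b))"
    by (simp add: rowel_def n sum_distrib_right mult.assoc)
  also have "\<dots> = torus_scalar (vpow i) * rowel b i (j - 1)"
    unfolding * rowel_def n(1) lbin_sum_Suc sum_distrib_left scalar_mult_assoc
    by (simp add: mult.commute)
  finally show ?thesis .
qed

lemma mon_X0_power: "mon i 0 * X0 b ^ n = torus_scalar (vpow (int n * i)) * rowel b i (- int n)"
proof (induction n)
  case (Suc n)
  have "mon i 0 * X0 b ^ Suc n = mon i 0 * X0 b ^ n * X0 b"
    by (simp add: power_Suc2 mult.assoc del: power_Suc)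
  also have "\<dots> = torus_scalar (vpow (int n * i)) * (rowel b i (- int n) * X0 b)"
    unfolding Suc by (simp add: mult.assoc)
  also have "\<dots> = torus_scalar (vpow (int n * i) * vpow i) * rowel b i (- int n - 1)"
    by (simp add: rowel_X0)
  also have "- int n - 1 = - int (Suc n)" by simp
  also have "vpow (int n * i) * vpow i = vpow (int (Suc n) * i)"
    by (simp add: algebra_simps flip: vpow_add)
  finally show ?case .
qed (simp add: rowel_nonneg)

lemma X3_colel:
  assumes "i \<le> 0"
  shows "X3 c * colel c i j = torus_scalar (vpow j) * colel c (i - 1) j"
proof -
  define n where "n = nat (- i)"
  have n: "nat (- (i - 1)) = Suc n" "int n = - i" "nat (- i) = n" using assms by (auto simp: n_def)
  have *: "X3 c * mon i (j + int c * int k) = torus_scalar (vpow j) * (torus_scalar (vpow (int c * int k)) * mon (i - 1) (j + int c * int k) +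
        torus_scalar (vpow (int c * (int k - int n))) * mon (i - 1) (j + int c * int (Suc k)))" for k
    by (simp add: X3_def distrib_left distrib_right mon_mult n(2) flip: vpow_add) (simp add: algebra_simps)
  have "X3 c * colel c i j = (\<Sum>k\<le>n. torus_scalar (lbin (int c) n k) * (X3 c * mon i (j + int c * int k)))"
    by (simp add: colel_def n sum_distrib_left scalar_left_commute[of "X3 c"])
  also have "\<dots> = torus_scalar (vpow j) * colel c (i - 1) j"
    unfolding * colel_def n(1) lbin_sum_Suc sum_distrib_left scalar_mult_assoc
    by (simp add: mult.commute)
  finally show ?thesis .
qed

lemma mon_colel: "mon 0 j' * colel c i j = torus_scalar (vpow (j' * i)) * colel c i (j + j')"
  by (auto simp: colel_def sum_distrib_left mon_scalar mon_mult algebra_simps intro!: sum.cong)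

text \<open>Its span is the algebra generated by \<open>X_1\<close>, \<open>X_3\<close>,
  \<open>X_2\<close> and \<open>X_2^(-1)\<close>.\<close>

definition colset :: "nat \<Rightarrow> qtorus set" where
  "colset c = {x. \<exists>i j. x = colel c i j}"

abbreviation colspan :: "nat \<Rightarrow> qtorus set" where
  "colspan c \<equiv> tspan (colset c)"

lemma colel_colspan: "colel c i j \<in> colspan c"
  by (rule tspan_base) (auto simp: colset_def)

lemma mon_colspan: "i \<ge> 0 \<Longrightarrow> mon i j \<in> colspan c"
  using colel_colspan[of c i j] by (simp add: colel_nonneg)

lemma X3_colspan: "x \<in> colspan c \<Longrightarrow> X3 c * x \<in> colspan c"
proof (erule tspan_mult_left, unfold colset_def, elim CollectE exE, fold colset_def)
  fix x i j assume x: "x = colel c i j"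
  show "X3 c * x \<in> colspan c"
  proof (cases "i \<le> 0")
    case True
    then show ?thesis by (simp add: x X3_colel tspan_scalar colel_colspan)
  next
    case False
    then show ?thesis
      by (auto simp: x colel_nonneg X3_def distrib_right mon_mult intro!: tspan_add tspan_scalar mon_colspan)
  qed
qed

lemma mon_0_colspan: "x \<in> colspan c \<Longrightarrow> mon 0 j * x \<in> colspan c"
  by (erule tspan_mult_left) (use colel_colspan in \<open>auto simp: colset_def mon_colel intro!: tspan_scalar\<close>)

text \<open>For negative \<open>i\<close> the generator has, up to a power of \<open>v\<close>, a
  left factor \<open>X_3\<close>, and the relation \<open>X_1 X_3 = 1 + v^(-c) X_2^c\<close> absorbs
  it.\<close>

lemma mon_1_colspan: "x \<in> colspan c \<Longrightarrow> mon 1 0 * x \<in> colspan c"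
proof (erule tspan_mult_left, unfold colset_def, elim CollectE exE, fold colset_def)
  fix x i j assume x: "x = colel c i j"
  show "mon 1 0 * x \<in> colspan c"
  proof (cases "i \<ge> 0")
    case True
    then show ?thesis by (auto simp: x colel_nonneg mon_mult intro!: tspan_scalar mon_colspan)
  next
    case False
    have "X3 c * colel c (i + 1) j = torus_scalar (vpow j) * colel c i j"
      using X3_colel[of "i + 1" c j] False by simp
    then have "torus_scalar (vpow (- j)) * (X3 c * colel c (i + 1) j) = x"
      by (simp add: x flip: vpow_add)
    then have "mon 1 0 * x = torus_scalar (vpow (- j)) * (mon 1 0 * X3 c * colel c (i + 1) j)"
      by (metis scalar_left_commute mult.assoc)
    moreover have "mon 1 0 * X3 c = 1 + torus_scalar (vpow (- int c)) * mon 0 (int c)"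
      by (simp add: X3_def distrib_left mon_mult)
    ultimately show ?thesis
      by (auto simp: distrib_right mult.assoc intro!: tspan_scalar tspan_add colel_colspan mon_0_colspan)
  qed
qed

lemma mon_nat_colspan: "x \<in> colspan c \<Longrightarrow> mon (int n) 0 * x \<in> colspan c"
proof (induction n)
  case (Suc n)
  have "mon (int (Suc n)) 0 = mon 1 0 * mon (int n) 0" by (simp add: mon_mult)
  then show ?case using Suc by (simp add: mult.assoc mon_1_colspan)
qed simp

text \<open>\<open>X_0 = X_2^(-1) (1 + v^b X_1^b)\<close> reduces this to closure under
  \<open>X_1\<close> and \<open>X_2^(-1)\<close>.\<close>

lemma X0_colspan: "x \<in> colspan c \<Longrightarrow> X0 b * x \<in> colspan c"
proof -
  assume x: "x \<in> colspan c"
  have "mon 0 (- 1) * mon (int b) 0 = torus_scalar (vpow (- int b)) * mon (int b) (- 1)"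
    by (simp add: mon_mult)
  then have "mon (int b) (- 1) = torus_scalar (vpow (int b)) * (mon 0 (- 1) * mon (int b) 0)"
    by (simp flip: vpow_add)
  then have "X0 b * x = mon 0 (- 1) * (x + torus_scalar (vpow (int b)) * (mon (int b) 0 * x))"
    by (simp add: X0_def distrib_left distrib_right mon_scalar mult.assoc)
  then show ?thesis
    using x by (simp add: mon_0_colspan tspan_add tspan_scalar mon_nat_colspan)
qed

text \<open>Generated inside the torus by four consecutive cluster variables, so that coefficients
  can be compared before anything is mapped to the skew field.\<close>

inductive_set subalg :: "nat \<Rightarrow> nat \<Rightarrow> qtorus set" for b c where
  scalar: "torus_scalar r \<in> subalg b c"
| X1: "mon 1 0 \<in> subalg b c"
| X2: "mon 0 1 \<in> subalg b c"
| X0: "X0 b \<in> subalg b c"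
| X3: "X3 c \<in> subalg b c"
| add: "x \<in> subalg b c \<Longrightarrow> y \<in> subalg b c \<Longrightarrow> x + y \<in> subalg b c"
| mult: "x \<in> subalg b c \<Longrightarrow> y \<in> subalg b c \<Longrightarrow> x * y \<in> subalg b c"

lemma subalg_mult_colspan: "x \<in> subalg b c \<Longrightarrow> y \<in> colspan c \<Longrightarrow> x * y \<in> colspan c"
  by (induction arbitrary: y rule: subalg.induct)
    (simp_all add: tspan_scalar mon_1_colspan mon_0_colspan X0_colspan X3_colspan distrib_right tspan_add mult.assoc)

lemma subalg_colspan: "x \<in> subalg b c \<Longrightarrow> x \<in> colspan c"
  using subalg_mult_colspan[of x b c 1] mon_colspan[of 0 0 c] by simp

lemma subalg_power: "x \<in> subalg b c \<Longrightarrow> x ^ n \<in> subalg b c"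
  by (induction n) (auto intro: subalg.mult subalg.scalar[of 1, simplified])

lemma mon_power1: "mon 1 0 ^ n = mon (int n) 0" "mon 0 1 ^ n = mon 0 (int n)"
  by (induction n) (simp_all add: mon_mult)

lemma mon_subalg:
  assumes "i \<ge> 0" "j \<ge> 0"
  shows "mon i j \<in> subalg b c"
proof -
  have "mon i j = torus_scalar (vpow (i * j)) * (mon 1 0 ^ nat i * mon 0 1 ^ nat j)"
    using assms by (simp add: mon_power1 mon_mult flip: vpow_add)
  then show ?thesis by (auto intro!: subalg.intros subalg_power)
qed

lemma colel_subalg:
  assumes "j \<ge> 0"
  shows "colel c i j \<in> subalg b c"
proof (cases "i \<ge> 0")
  case True
  then show ?thesis using assms by (simp add: colel_nonneg mon_subalg)
next
  case False
  have "colel c (- int n) j \<in> subalg b c" for n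
  proof (induction n)
    case 0
    then show ?case using assms by (simp add: colel_nonneg mon_subalg)
  next
    case (Suc n)
    have "X3 c * colel c (- int n) j = torus_scalar (vpow j) * colel c (- int (Suc n)) j"
    proof -
      have *: "- int (Suc n) = - int n - 1" by simp
      show ?thesis unfolding * by (rule X3_colel) simp
    qed
    then have "colel c (- int (Suc n)) j = torus_scalar (vpow (- j)) * (X3 c * colel c (- int n) j)"
      by (simp flip: vpow_add)
    then show ?case using Suc by (auto intro: subalg.intros)
  qed
  from this[of "nat (- i)"] show ?thesis using False by simp
qed

text \<open>The row analogue of \<open>colset\<close>, filtered by the degree \<open>N\<close> in
  \<open>X_0\<close> so that membership can be proved by induction on it.\<close>

definition rowset :: "nat \<Rightarrow> nat \<Rightarrow> qtorus set" where
  "rowset b N = {x. \<exists>i n. n \<le> N \<and> x = mon i 0 * X0 b ^ n} \<union> {x. \<exists>i j. j \<ge> 0 \<and> x = mon i j}"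

abbreviation rowspan :: "nat \<Rightarrow> nat \<Rightarrow> qtorus set" where
  "rowspan b N \<equiv> tspan (rowset b N)"

lemma rowspan_mono: "x \<in> rowspan b n \<Longrightarrow> n \<le> N \<Longrightarrow> x \<in> rowspan b N"
  by (erule tspan_mono) (unfold rowset_def, blast intro: order_trans)

text \<open>\<open>X_2 X_0\<close> is a polynomial in \<open>X_1\<close>, so a factor
  \<open>X_2\<close> meeting \<open>X_0\<close> lowers the degree in \<open>X_0\<close> by
  one.\<close>

lemma mon_X0_rowspan:
  assumes "j \<ge> 0"
  shows "mon i j * X0 b ^ n \<in> rowspan b n"
    and "j \<ge> 1 \<Longrightarrow> mon i j * X0 b ^ Suc n \<in> rowspan b n"
proof -
  have step: "mon i (j + 1) * X0 b ^ Suc n = torus_scalar (vpow i) * (mon i j * X0 b ^ n) +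
      torus_scalar (vpow (i + int b + j * int b)) * (mon (i + int b) j * X0 b ^ n)" for i j n
  proof -
    have "mon i (j + 1) * X0 b = torus_scalar (vpow i) * mon i j + torus_scalar (vpow (i + int b + j * int b)) * mon (i + int b) j"
      by (simp add: X0_def distrib_left mon_mult algebra_simps)
    then show ?thesis by (simp add: distrib_right flip: mult.assoc)
  qed
  have *: "\<forall>i j. j \<ge> 0 \<longrightarrow> mon i j * X0 b ^ n \<in> rowspan b n" for n
  proof (induction n)
    case 0
    then show ?case by (auto simp: rowset_def intro!: tspan_base)
  next
    case (Suc n)
    show ?case
    proof (intro allI impI)
      fix i j :: int assume "j \<ge> 0"
      show "mon i j * X0 b ^ Suc n \<in> rowspan b (Suc n)"
      proof (cases "j = 0")
        case True
        then show ?thesis by (intro tspan_base) (auto simp: rowset_def simp del: power_Suc)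
      next
        case False
        then have "mon i j * X0 b ^ Suc n \<in> rowspan b n"
          using step[of i "j - 1" n] Suc \<open>j \<ge> 0\<close>
          by (simp del: power_Suc add: tspan_add tspan_scalar)
        then show ?thesis by (rule rowspan_mono) simp
      qed
    qed
  qed
  show "mon i j * X0 b ^ n \<in> rowspan b n" using * assms by blast
  show "mon i j * X0 b ^ Suc n \<in> rowspan b n" if "j \<ge> 1"
    using step[of i "j - 1" n] * that by (simp del: power_Suc add: tspan_add tspan_scalar)
qed

lemma rowspan_reduce:
  assumes "c > 0" "x \<in> rowspan b (Suc N)"
  obtains y where "y \<in> subalg b c" "x - y \<in> rowspan b N"
proof -
  have "\<exists>y \<in> subalg b c. x - y \<in> rowspan b N"
    using assms(2)
  proof (induction rule: tspan.induct)
    case zero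
    show ?case using subalg.scalar[of 0 b c] by (auto intro!: bexI[of _ 0] simp: tspan.zero)
  next
    case (add g x r)
    then obtain y where y: "y \<in> subalg b c" "x - y \<in> rowspan b N" by blast
    have "\<exists>z \<in> subalg b c. g - z \<in> rowspan b N"
    proof (cases "g \<in> rowset b N")
      case True
      then show ?thesis using subalg.scalar[of 0 b c] tspan_base[OF True] by (auto intro!: bexI[of _ 0])
    next
      case False
      then obtain i where g: "g = mon i 0 * X0 b ^ Suc N"
        using add(1) by (auto simp: rowset_def le_Suc_eq simp del: power_Suc)
      \<comment> \<open>For \<open>i < 0\<close> this replaces \<open>X_1^i\<close> by
        \<open>X_3^(-i)\<close>, up to a power of \<open>v\<close>. The \<open>k = 0\<close> term is
        \<open>g\<close>; the others contain a positive power of \<open>X_2\<close>, as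
        \<open>c > 0\<close>, and drop to degree \<open>N\<close>.\<close>
      define z where "z = colel c i 0 * X0 b ^ Suc N"
      have "z \<in> subalg b c"
        unfolding z_def by (intro subalg.mult colel_subalg subalg_power subalg.X0) simp
      moreover have "colel c i 0 = mon i 0 + (\<Sum>k<nat (- i). torus_scalar (lbin (int c) (nat (- i)) (Suc k)) * mon i (int c * int (Suc k)))"
        unfolding colel_def by (subst sum.atMost_shift) simp
      then have "g - z = - (\<Sum>k<nat (- i). torus_scalar (lbin (int c) (nat (- i)) (Suc k)) * (mon i (int c * int (Suc k)) * X0 b ^ Suc N))"
        unfolding g z_def by (simp only: distrib_right sum_distrib_right mult.assoc) simp
      moreover have "\<dots> \<in> rowspan b N"
        using assms(1) by (intro tspan_uminus tspan_sum tspan_scalar mon_X0_rowspan(2)) (simp_all add: int_one_le_iff_zero_less)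
      ultimately show ?thesis by metis
    qed
    then obtain z where z: "z \<in> subalg b c" "g - z \<in> rowspan b N" by blast
    have *: "torus_scalar r * g + x - (torus_scalar r * z + y) = torus_scalar r * (g - z) + (x - y)"
      by (simp add: algebra_simps)
    have "torus_scalar r * g + x - (torus_scalar r * z + y) \<in> rowspan b N"
      unfolding * using y z by (intro tspan_add tspan_scalar)
    then show ?case using y z by (meson subalg.intros)
  qed
  then show ?thesis using that by blast
qed

section \<open>Elimination of negative powers of \<open>X_2\<close>\<close>

lemma mcoeff_rowspan_0: "x \<in> rowspan b 0 \<Longrightarrow> j < 0 \<Longrightarrow> mcoeff i j x = 0"
  by (induction rule: tspan.induct) (auto simp: rowset_def mcoeff_add mcoeff_scalar mcoeff_mon)

text \<open>Every term of a column element except \<open>k = 0\<close> has a strictly larger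
  exponent of \<open>X_2\<close>, so column elements are triangular with leading coefficient
  1.\<close>

lemma mcoeff_colel:
  assumes "c > 0" "j \<le> j'"
  shows "mcoeff i j (colel c i' j') = (if i = i' \<and> j = j' then 1 else 0)"
proof -
  have "mcoeff i j (colel c i' j') = (\<Sum>k\<le>nat (- i'). if k = 0 then (if i = i' \<and> j = j' then 1 else 0) else 0)"
    unfolding colel_def mcoeff_sum mcoeff_scalar mcoeff_mon
  proof (intro sum.cong refl)
    fix k
    have "j < j' + int c * int k" if "k > 0" using assms that by (smt (verit) of_nat_0_less_iff zero_less_mult_iff)
    then show "lbin (int c) (nat (- i')) k * (if i = i' \<and> j = j' + int c * int k then 1 else 0) =
        (if k = 0 then (if i = i' \<and> j = j' then 1 else 0) else 0)" by auto
  qed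
  then show ?thesis by simp
qed

definition collow :: "nat \<Rightarrow> nat \<Rightarrow> qtorus set" where
  "collow c K = {colel c i j | i j. j \<ge> - int K}"

lemma collow_reduce:
  assumes "c > 0" "x \<in> tspan (collow c (Suc K))" "\<And>i. mcoeff i (- int (Suc K)) x = 0"
  shows "x \<in> tspan (collow c K)"
proof -
  let ?j = "- int (Suc K)"
  \<comment> \<open>Subtracting the layer of exponent \<open>-(K + 1)\<close>, as read off by
    \<open>mcoeff\<close>, lands in the smaller span. Demanding this for every finite
    \<open>J\<close> containing \<open>I\<close> allows \<open>I\<close> to grow with each new
    summand.\<close>
  have "\<exists>I. finite I \<and> (\<forall>J. finite J \<longrightarrow> I \<subseteq> J \<longrightarrow>
      x - (\<Sum>i\<in>J. torus_scalar (mcoeff i ?j x) * colel c i ?j) \<in> tspan (collow c K))"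
    using assms(2)
  proof (induction rule: tspan.induct)
    case zero
    show ?case by (auto simp: tspan.zero)
  next
    case (add g x r)
    then obtain I where I: "finite I" "\<And>J. finite J \<Longrightarrow> I \<subseteq> J \<Longrightarrow>
      x - (\<Sum>i\<in>J. torus_scalar (mcoeff i ?j x) * colel c i ?j) \<in> tspan (collow c K)" by blast
    obtain i' j' where g: "g = colel c i' j'" "?j \<le> j'" using add(1) by (auto simp: collow_def)
    have "torus_scalar r * g + x - (\<Sum>i\<in>J. torus_scalar (mcoeff i ?j (torus_scalar r * g + x)) * colel c i ?j) \<in> tspan (collow c K)"
      if J: "finite J" "insert i' I \<subseteq> J" for J
    proof -
      have "(\<Sum>i\<in>J. torus_scalar (mcoeff i ?j (torus_scalar r * g + x)) * colel c i ?j) =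
          (\<Sum>i\<in>J. if i = i' then (if j' = ?j then torus_scalar r * g else 0) else 0) +
          (\<Sum>i\<in>J. torus_scalar (mcoeff i ?j x) * colel c i ?j)"
        unfolding sum.distrib[symmetric]
        by (intro sum.cong refl) (use assms(1) g in \<open>auto simp: mcoeff_add mcoeff_scalar mcoeff_colel torus_scalar_add distrib_right\<close>)
      moreover have "(\<Sum>i\<in>J. if i = i' then (if j' = ?j then torus_scalar r * g else 0) else 0) = (if j' = ?j then torus_scalar r * g else 0)"
        using J by simp
      moreover have "torus_scalar r * g - (if j' = ?j then torus_scalar r * g else 0) \<in> tspan (collow c K)"
      proof (cases "j' = ?j")
        case False
        then have "- int K \<le> j'" using g(2) by simp
        then have "g \<in> collow c K" using g(1) by (auto simp: collow_def)
        then show ?thesis using False by (simp add: tspan_scalar tspan_base)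
      qed (simp add: tspan.zero)
      ultimately show ?thesis
        using tspan_add[OF _ I(2)[OF J(1)], of "torus_scalar r * g - (if j' = ?j then torus_scalar r * g else 0)"] J(2)
        by (simp add: algebra_simps)
    qed
    then show ?case using I(1) by (intro exI[of _ "insert i' I"]) simp
  qed
  then show ?thesis using assms(3) by auto
qed

lemma colspan_low:
  assumes "x \<in> colspan c"
  obtains K where "x \<in> tspan (collow c K)"
proof -
  have mono: "y \<in> tspan (collow c K) \<Longrightarrow> K \<le> L \<Longrightarrow> y \<in> tspan (collow c L)" for y K L
    by (erule tspan_mono) (force simp: collow_def)
  have "\<exists>K. x \<in> tspan (collow c K)" using assms
  proof (induction rule: tspan.induct)
    case zero
    show ?case by (simp add: tspan.zero)
  next
    case (add g x r)
    then obtain K i j where *: "x \<in> tspan (collow c K)" "g = colel c i j" by (auto simp: colset_def)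
    moreover have "- int (max K (nat (- j))) \<le> j" by simp
    ultimately have "g \<in> collow c (max K (nat (- j)))" unfolding collow_def by blast
    then have "g \<in> tspan (collow c (max K (nat (- j))))" "x \<in> tspan (collow c (max K (nat (- j))))"
      using mono[OF *(1), of "max K (nat (- j))"] by (auto intro: tspan_base)
    then show ?case by (meson tspan_add tspan_scalar)
  qed
  then show ?thesis using that by blast
qed

lemma subalg_span_0: "x \<in> tspan (collow c 0) \<Longrightarrow> x \<in> subalg b c"
proof (induction rule: tspan.induct)
  case zero
  show ?case using subalg.scalar[of 0] by simp
next
  case (add x y r)
  then show ?case by (auto simp: collow_def intro!: subalg.intros colel_subalg)
qed

text \<open>Peeling off the top power of \<open>X_0\<close> stays in \<open>colspan\<close>, which
  contains the subalgebra. In degree 0 no negative power of \<open>X_2\<close> is left, so the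
  lowest layers of the column expansion vanish one after another.\<close>

theorem rowspan_colspan_subalg:
  assumes "c > 0" "x \<in> rowspan b N" "x \<in> colspan c"
  shows "x \<in> subalg b c"
  using assms(2,3)
proof (induction N arbitrary: x)
  case 0
  obtain K where "x \<in> tspan (collow c K)" using colspan_low[OF 0(2)] by blast
  then have "x \<in> tspan (collow c 0)"
  proof (induction K)
    case (Suc K)
    then show ?case using collow_reduce[OF assms(1)] mcoeff_rowspan_0[OF 0(1)] by simp
  qed
  then show ?case by (rule subalg_span_0)
next
  case (Suc N)
  obtain y where y: "y \<in> subalg b c" "x - y \<in> rowspan b N"
    using rowspan_reduce[OF assms(1) Suc.prems(1)] by blast
  have "x - y \<in> subalg b c"
    using Suc.IH[OF y(2)] y(1) Suc.prems(2) by (simp add: tspan_diff subalg_colspan)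
  then show ?case using subalg.add[OF _ y(1), of "x - y"] by simp
qed

section \<open>The greedy recurrence\<close>

lemma Hser_0 [simp]: "fps_nth (Hser b n) 0 = 1"
  by (simp add: Hser_def)

text \<open>\<open>Hser\<close> starts with 1, so the \<open>k = 0\<close> term of the product
  isolates \<open>u p\<close>.\<close>

lemma recurrence_iff:
  "fps_nth (Abs_fps u * Hser b n) p = 0 \<longleftrightarrow>
     u p = (\<Sum>k = 1..p. (-1) ^ (k - 1) * u (p - k) * lbin b (n + k - 1) k)"
proof -
  have "fps_nth (Abs_fps u * Hser b n) p = (\<Sum>k = 0..p. fps_nth (Hser b n) k * u (p - k))"
    by (subst mult.commute) (simp add: fps_mult_nth)
  also have "\<dots> = u p + (\<Sum>k = 1..p. fps_nth (Hser b n) k * u (p - k))"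
    by (simp add: sum.atLeast_Suc_atMost)
  also have "(\<Sum>k = 1..p. fps_nth (Hser b n) k * u (p - k)) =
      - (\<Sum>k = 1..p. (-1) ^ (k - 1) * u (p - k) * lbin b (n + k - 1) k)"
    unfolding sum_negf[symmetric]
  proof (intro sum.cong refl)
    fix k assume "k \<in> {1..p}"
    then obtain j where "k = Suc j" by (cases k) auto
    then show "fps_nth (Hser b n) k * u (p - k) = - ((-1) ^ (k - 1) * u (p - k) * lbin b (n + k - 1) k)"
      by (simp add: Hser_def mult_ac)
  qed
  finally show ?thesis by simp
qed

lemma recurrence_sum_0:
  "(\<Sum>k = 1..p. (-1) ^ (k - 1) * u (p - k) * lbin b (0 + k - 1) k) = 0"
  by (intro sum.neutral) (auto simp: lbin_eq_0)

text \<open>The constant term 1 of \<open>h\<close> makes the last coefficient determined by the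
  product and the earlier ones: the induction step for comparing two solutions of a
  recurrence.\<close>

lemma fps_mult_nth_cancel:
  fixes f g h :: "'a::comm_ring_1 fps"
  assumes "fps_nth (f * h) p = fps_nth (g * h) p" "fps_nth h 0 = 1" "\<And>i. i < p \<Longrightarrow> fps_nth f i = fps_nth g i"
  shows "fps_nth f p = fps_nth g p"
proof -
  have "fps_nth (u * h) p = (\<Sum>i<p. fps_nth u i * fps_nth h (p - i)) + fps_nth u p" for u :: "'a fps"
    using assms(2) by (simp add: fps_mult_nth atLeast0AtMost lessThan_Suc_atMost[symmetric])
  then show ?thesis using assms(1,3) by simp
qed

text \<open>At a tie the row equation is taken as definition; the column equation there is the real
  claim, proved in \<open>greedy_col\<close>.\<close>

function greedy_coeff :: "nat \<Rightarrow> nat \<Rightarrow> int \<Rightarrow> int \<Rightarrow> nat \<Rightarrow> nat \<Rightarrow> laurent" where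
  "greedy_coeff b c a1 a2 p q =
     (if p = 0 \<and> q = 0 then 1
      else if int c * a1 * int q \<le> int b * a2 * int p then
        (\<Sum>k = 1..p. (-1) ^ (k - 1) * greedy_coeff b c a1 a2 (p - k) q *
          lbin (int b) (nat (a2 - int c * int q) + k - 1) k)
      else
        (\<Sum>l = 1..q. (-1) ^ (l - 1) * greedy_coeff b c a1 a2 p (q - l) *
          lbin (int c) (nat (a1 - int b * int p) + l - 1) l))"
  by auto
termination by (relation "measure (\<lambda>(b, c, a1, a2, p, q). p + q)") auto

declare greedy_coeff.simps [simp del]

text \<open>\<open>P Q < a2 P = a1 Q\<close>. Thus a tie at which one of the two equations is
  nontrivial lies inside the rectangle, where the factorization applies.\<close>

lemma tie_interior:
  fixes P Q a1 a2 :: int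
  assumes "a1 * Q = a2 * P" "Q < a2" "0 < P" "0 \<le> Q"
  shows "P < a1"
proof -
  have "0 < a2 * P" using assms by simp
  then have "0 < a1 * Q" using assms by simp
  then have "Q \<noteq> 0" by auto
  then have "0 < Q" using assms by simp
  have "P * Q < a2 * P" using assms by (simp add: mult.commute)
  also have "\<dots> = a1 * Q" using assms by simp
  finally show ?thesis using \<open>0 < Q\<close> by simp
qed

lemma fps_product_bound:
  fixes f g :: "'a::comm_ring_1 fps"
  assumes "\<And>i. i \<ge> N \<Longrightarrow> fps_nth f i = 0" "\<And>i. i > n \<Longrightarrow> fps_nth g i = 0" "m \<ge> N + n"
  shows "fps_nth (g * f) m = 0"
  unfolding fps_mult_nth
proof (intro sum.neutral ballI)
  fix i show "fps_nth g i * fps_nth f (m - i) = 0"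
    using assms by (cases "i > n") auto
qed

text \<open>Divisibility by \<open>Bser d n\<close> with polynomial quotient \<open>f\<close> groups
  a row or column into products of length \<open>n\<close>, which become \<open>rowel\<close> or
  \<open>colel\<close>.\<close>

lemma expansion_sum:
  fixes M :: "nat \<Rightarrow> qtorus"
  assumes u: "Abs_fps u = Bser d n * f" and f: "\<And>i. i \<ge> N \<Longrightarrow> fps_nth f i = 0" and P: "P \<ge> N + n"
  shows "(\<Sum>m\<le>P. torus_scalar (u m) * M m) =
    (\<Sum>i<N. torus_scalar (fps_nth f i) * (\<Sum>k\<le>n. torus_scalar (lbin d n k) * M (i + k)))"
proof -
  let ?g = "\<lambda>i k. torus_scalar (fps_nth f i * lbin d n k) * M (i + k)"
  have scalar_sum: "torus_scalar (\<Sum>i\<in>A. h i) = (\<Sum>i\<in>A. torus_scalar (h i))" for A :: "nat set" and h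
    by (induction A rule: infinite_finite_induct) (simp_all add: torus_scalar_add)
  have "u m = (\<Sum>i\<le>m. fps_nth f i * lbin d n (m - i))" for m
    using arg_cong[OF u, of "\<lambda>h. fps_nth h m"]
    by (subst (asm) mult.commute) (simp add: fps_mult_nth Bser_def atLeast0AtMost)
  then have "(\<Sum>m\<le>P. torus_scalar (u m) * M m) = (\<Sum>m\<le>P. \<Sum>i\<le>m. ?g i (m - i))"
    by (simp add: scalar_sum sum_distrib_right)
  also have "\<dots> = (\<Sum>(i, k)\<in>{(i, k). i + k \<le> P}. ?g i k)"
    by (rule sum.triangle_reindex_eq[symmetric])
  also have "\<dots> = (\<Sum>(i, k)\<in>{..<N} \<times> {..n}. ?g i k)"
  proof (rule sum.mono_neutral_right)
    show "finite {(i, k). i + k \<le> P}"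
      by (rule finite_subset[of _ "{..P} \<times> {..P}"]) auto
    show "{..<N} \<times> {..n} \<subseteq> {(i, k). i + k \<le> P}" using P by auto
    show "\<forall>x\<in>{(i, k). i + k \<le> P} - {..<N} \<times> {..n}. (case x of (i, k) \<Rightarrow> ?g i k) = 0"
    proof
      fix x assume "x \<in> {(i, k). i + k \<le> P} - {..<N} \<times> {..n}"
      moreover obtain i k where x: "x = (i, k)" by (cases x)
      ultimately have "(i, k) \<notin> {..<N} \<times> {..n}" by blast
      then have *: "fps_nth f i * lbin d n k = 0"
        using f[of i] lbin_eq_0[of n k d] by (cases "i < N") auto
      show "(case x of (i, k) \<Rightarrow> ?g i k) = 0" unfolding x prod.case * by simp
    qed
  qed
  also have "\<dots> = (\<Sum>i<N. \<Sum>k\<le>n. ?g i k)"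
    by (rule sum.cartesian_product[symmetric])
  finally show ?thesis by (simp add: sum_distrib_left)
qed

lemma rowel_rowspan:
  assumes "j \<ge> - int N"
  shows "rowel b i j \<in> rowspan b N"
proof (cases "j \<ge> 0")
  case True
  then show ?thesis by (auto simp: rowel_nonneg rowset_def intro!: tspan_base)
next
  case False
  define n where "n = nat (- j)"
  have j: "j = - int n" and "n \<le> N" using False assms by (auto simp: n_def)
  have "mon i 0 * X0 b ^ n = torus_scalar (vpow (int n * i)) * rowel b i j"
    unfolding j by (rule mon_X0_power)
  then have "rowel b i j = torus_scalar (vpow (- (int n * i))) * (mon i 0 * X0 b ^ n)"
    by (simp flip: vpow_add)
  moreover have "mon i 0 * X0 b ^ n \<in> rowset b N" using \<open>n \<le> N\<close> by (auto simp: rowset_def)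
  ultimately show ?thesis by (simp add: tspan_scalar tspan_base)
qed

definition greedy_element :: "nat \<Rightarrow> nat \<Rightarrow> int \<Rightarrow> int \<Rightarrow> qtorus" where
  "greedy_element b c a1 a2 = (\<Sum>(p, q)\<in>{(p, q). greedy_coeff b c a1 a2 p q \<noteq> 0}.
    torus_scalar (greedy_coeff b c a1 a2 p q) * mon (int b * int p - a1) (int c * int q - a2))"

section \<open>The greedy coefficients: both recurrences, finite support, membership\<close>

context
  fixes b c :: nat and a1 a2 :: int
  assumes b: "b > 0" and c: "c > 0"
begin

private abbreviation "coef \<equiv> greedy_coeff b c a1 a2"
private abbreviation "rowlen q \<equiv> nat (a2 - int c * int q)"
private abbreviation "collen p \<equiv> nat (a1 - int b * int p)"
private abbreviation "row q \<equiv> Abs_fps (\<lambda>i. coef i q) * Hser (int b) (rowlen q)"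
private abbreviation "col p \<equiv> Abs_fps (\<lambda>j. coef p j) * Hser (int c) (collen p)"

lemma greedy_coeff_0: "coef 0 0 = 1"
  by (simp add: greedy_coeff.simps)

lemma greedy_row:
  assumes "(p, q) \<noteq> (0, 0)" "int c * a1 * int q \<le> int b * a2 * int p"
  shows "fps_nth (row q) p = 0"
  unfolding recurrence_iff using assms by (subst greedy_coeff.simps) auto

lemma greedy_col_strict:
  assumes "int c * a1 * int q > int b * a2 * int p"
  shows "fps_nth (col p) q = 0"
proof -
  have "\<not> (p = 0 \<and> q = 0)"
  proof
    assume "p = 0 \<and> q = 0"
    then show False using assms by simp
  qed
  then show ?thesis
    unfolding recurrence_iff using assms by (subst greedy_coeff.simps) auto
qed

text \<open>Inside the rectangle both families obey the same recurrence, and the earlier points it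
  refers to stay inside.\<close>

lemma greedy_eq_pointed:
  obtains g :: "nat \<Rightarrow> nat \<Rightarrow> laurent fract" where
    "\<And>p q. int b * int p \<le> a1 \<Longrightarrow> int c * int q \<le> a2 \<Longrightarrow> to_fract (coef p q) = g p q"
    "\<And>p q. (p, q) \<noteq> (0, 0) \<Longrightarrow> int b * int p \<le> a1 \<Longrightarrow> int c * a1 * int q \<ge> int b * a2 * int p \<Longrightarrow>
       fps_nth (Abs_fps (\<lambda>j. g p j) * tofps (Hser (int c) (collen p))) q = 0"
proof -
  obtain g :: "nat \<Rightarrow> nat \<Rightarrow> laurent fract" where g: "g 0 0 = 1"
    "\<And>p q. (p, q) \<noteq> (0, 0) \<Longrightarrow> int c * int q \<le> a2 \<Longrightarrow> int c * a1 * int q \<le> int b * a2 * int p \<Longrightarrow>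
       fps_nth (Abs_fps (\<lambda>i. g i q) * tofps (Hser (int b) (rowlen q))) p = 0"
    "\<And>p q. (p, q) \<noteq> (0, 0) \<Longrightarrow> int b * int p \<le> a1 \<Longrightarrow> int c * a1 * int q \<ge> int b * a2 * int p \<Longrightarrow>
       fps_nth (Abs_fps (\<lambda>j. g p j) * tofps (Hser (int c) (collen p))) q = 0"
    using pointed_recurrences[OF b c, of a2 a1] by blast
  have "to_fract (coef p q) = g p q" if "int b * int p \<le> a1" "int c * int q \<le> a2" for p q
    using that
  proof (induction "p + q" arbitrary: p q rule: less_induct)
    case less
    show ?case
    proof (cases "(p, q) = (0, 0)")
      case True
      then show ?thesis using g(1) by (simp add: greedy_coeff_0)
    next
      case nz: False
      have smaller: "int b * int i \<le> a1" if "i \<le> p" for i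
        using less.prems(1) that by (smt (verit) mult_left_mono of_nat_0_le_iff of_nat_le_iff)
      have smaller': "int c * int j \<le> a2" if "j \<le> q" for j
        using less.prems(2) that by (smt (verit) mult_left_mono of_nat_0_le_iff of_nat_le_iff)
      show ?thesis
      proof (cases "int c * a1 * int q \<le> int b * a2 * int p")
        case True
        have "fps_nth (tofps (Abs_fps (\<lambda>i. coef i q))) p = fps_nth (Abs_fps (\<lambda>i. g i q)) p"
        proof (rule fps_mult_nth_cancel)
          show "fps_nth (tofps (Abs_fps (\<lambda>i. coef i q)) * tofps (Hser (int b) (rowlen q))) p =
              fps_nth (Abs_fps (\<lambda>i. g i q) * tofps (Hser (int b) (rowlen q))) p"
            using g(2)[OF nz less.prems(2) True] greedy_row[OF nz True] by (simp flip: tofps_mult)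
        qed (use less.hyps less.prems smaller in auto)
        then show ?thesis by simp
      next
        case False
        have "fps_nth (tofps (Abs_fps (\<lambda>j. coef p j))) q = fps_nth (Abs_fps (\<lambda>j. g p j)) q"
        proof (rule fps_mult_nth_cancel)
          show "fps_nth (tofps (Abs_fps (\<lambda>j. coef p j)) * tofps (Hser (int c) (collen p))) q =
              fps_nth (Abs_fps (\<lambda>j. g p j) * tofps (Hser (int c) (collen p))) q"
            using g(3)[OF nz less.prems(1)] greedy_col_strict[of p q] False by (simp flip: tofps_mult)
        qed (use less.hyps less.prems smaller' in auto)
        then show ?thesis by simp
      qed
    qed
  qed
  then show ?thesis using that g(3) by blast
qed

text \<open>Away from ties this is the definition; at a tie inside the rectangle the column equation
  is inherited from the factorization through \<open>greedy_eq_pointed\<close>.\<close>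

lemma greedy_col:
  assumes nz: "(p, q) \<noteq> (0, 0)" and ge: "int c * a1 * int q \<ge> int b * a2 * int p"
  shows "fps_nth (col p) q = 0"
proof (cases "int c * a1 * int q = int b * a2 * int p")
  case False
  then show ?thesis using greedy_col_strict ge by simp
next
  case True
  let ?P = "int b * int p" and ?Q = "int c * int q"
  have tie: "a1 * ?Q = a2 * ?P" using True by (simp add: mult_ac)
  show ?thesis
  proof (cases "(?Q < a2 \<and> 0 < ?P) \<or> (?P < a1 \<and> 0 < ?Q)")
    case True
    then have "?P < a1" "?Q < a2"
      using tie_interior[of a1 ?Q a2 ?P] tie_interior[of a2 ?P a1 ?Q] tie by auto
    obtain g :: "nat \<Rightarrow> nat \<Rightarrow> laurent fract" where g:
      "\<And>p q. int b * int p \<le> a1 \<Longrightarrow> int c * int q \<le> a2 \<Longrightarrow> to_fract (coef p q) = g p q"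
      "\<And>p q. (p, q) \<noteq> (0, 0) \<Longrightarrow> int b * int p \<le> a1 \<Longrightarrow> int c * a1 * int q \<ge> int b * a2 * int p \<Longrightarrow>
       fps_nth (Abs_fps (\<lambda>j. g p j) * tofps (Hser (int c) (collen p))) q = 0"
      using greedy_eq_pointed by blast
    have "to_fract (coef p j) = g p j" if "j \<le> q" for j
    proof (rule g(1))
      have "int c * int j \<le> ?Q" using that by (simp add: mult_left_mono)
      then show "int c * int j \<le> a2" using \<open>?Q < a2\<close> by simp
    qed (use \<open>?P < a1\<close> in simp)
    then have "fps_nth (tofps (Abs_fps (\<lambda>j. coef p j)) * tofps (Hser (int c) (collen p))) q =
        fps_nth (Abs_fps (\<lambda>j. g p j) * tofps (Hser (int c) (collen p))) q"
      by (simp add: fps_mult_nth)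
    also have "\<dots> = 0" using g(2)[OF nz] \<open>?P < a1\<close> ge by simp
    finally show ?thesis by (simp flip: tofps_mult)
  next
    case False
    \<comment> \<open>Each equation now has an empty sum or truncation 0, which makes every binomial
      vanish; both merely say \<open>coef p q = 0\<close>.\<close>
    then have *: "rowlen q = 0 \<or> p = 0" "collen p = 0 \<or> q = 0" using b c by auto
    have "coef p q = (\<Sum>k = 1..p. (-1) ^ (k - 1) * coef (p - k) q * lbin (int b) (rowlen q + k - 1) k)"
      using greedy_row[OF nz] True unfolding recurrence_iff by simp
    also have "\<dots> = 0" using *(1) recurrence_sum_0[of "\<lambda>i. coef i q" p "int b"] by auto
    finally have "coef p q = 0" .
    moreover have "(\<Sum>l = 1..q. (-1) ^ (l - 1) * coef p (q - l) * lbin (int c) (collen p + l - 1) l) = 0"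
      using *(2) recurrence_sum_0[of "\<lambda>j. coef p j" q "int c"] by auto
    ultimately show ?thesis unfolding recurrence_iff by simp
  qed
qed

text \<open>Here \<open>a2 > 0\<close>, so far out in the row the row equation is in force and the
  quotient by \<open>Bser\<close> is a polynomial. The \<open>+ 1\<close> excludes the
  origin.\<close>

lemma row_bound:
  assumes "int c * int q < a2" "p \<ge> nat (int c * a1 * int q) + 1"
  shows "fps_nth (row q) p = 0"
proof (rule greedy_row)
  have "int c * int q \<ge> 0" by simp
  then have "a2 > 0" using assms(1) by linarith
  then have "1 * int p \<le> (int b * a2) * int p" using b by (intro mult_right_mono) (auto simp: int_one_le_iff_zero_less)
  moreover have "int c * a1 * int q \<le> int p" using assms(2) by linarith
  ultimately show "int c * a1 * int q \<le> int b * a2 * int p" by linarith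
qed (use assms in auto)

lemma col_bound:
  assumes "int b * int p < a1" "q \<ge> nat (int b * a2 * int p) + 1"
  shows "fps_nth (col p) q = 0"
proof (rule greedy_col)
  have "int b * int p \<ge> 0" by simp
  then have "a1 > 0" using assms(1) by linarith
  then have "1 * int q \<le> (int c * a1) * int q" using c by (intro mult_right_mono) (auto simp: int_one_le_iff_zero_less)
  moreover have "int b * a2 * int p \<le> int q" using assms(2) by linarith
  ultimately show "int c * a1 * int q \<ge> int b * a2 * int p" by linarith
qed (use assms in auto)

lemma row_expansion: "Abs_fps (\<lambda>i. coef i q) = Bser (int b) (rowlen q) * row q"
  using Bser_Hser[of "int b" "rowlen q"] by (metis mult.left_commute mult.right_neutral)

lemma col_expansion: "Abs_fps (\<lambda>j. coef p j) = Bser (int c) (collen p) * col p"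
  using Bser_Hser[of "int c" "collen p"] by (metis mult.left_commute mult.right_neutral)

lemma Bser_bound: "i > n \<Longrightarrow> fps_nth (Bser d n) i = 0"
  by (simp add: Bser_def lbin_eq_0)

lemma greedy_row_finite: "int c * int q < a2 \<Longrightarrow> finite {p. coef p q \<noteq> 0}"
proof -
  assume q: "int c * int q < a2"
  have "coef p q = 0" if "p \<ge> nat (int c * a1 * int q) + 1 + rowlen q" for p
    using fps_product_bound[OF row_bound[OF q] Bser_bound that] row_expansion[of q]
    by (metis fps_nth_Abs_fps)
  then have "{p. coef p q \<noteq> 0} \<subseteq> {..<nat (int c * a1 * int q) + 1 + rowlen q}"
    using not_less by blast
  then show ?thesis by (rule finite_subset) simp
qed

lemma greedy_col_finite: "int b * int p < a1 \<Longrightarrow> finite {q. coef p q \<noteq> 0}"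
proof -
  assume p: "int b * int p < a1"
  have "coef p q = 0" if "q \<ge> nat (int b * a2 * int p) + 1 + collen p" for q
    using fps_product_bound[OF col_bound[OF p] Bser_bound that] col_expansion[of p]
    by (metis fps_nth_Abs_fps)
  then have "{q. coef p q \<noteq> 0} \<subseteq> {..<nat (int b * a2 * int p) + 1 + collen p}"
    using not_less by blast
  then show ?thesis by (rule finite_subset) simp
qed

text \<open>Only finitely many rows and columns have a positive truncation, each with finite
  support; at any other point but the origin the recurrence gives 0.\<close>

lemma greedy_finite: "finite {(p, q). coef p q \<noteq> 0}"
proof (rule finite_subset)
  let ?R = "{q. int c * int q < a2}" and ?C = "{p. int b * int p < a1}"
  have "?R \<subseteq> {..nat a2}"
  proof
    fix q assume "q \<in> ?R"
    moreover have "1 * int q \<le> int c * int q" using c by (intro mult_right_mono) auto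
    ultimately show "q \<in> {..nat a2}" by simp
  qed
  then have R: "finite ?R" by (rule finite_subset) simp
  have "?C \<subseteq> {..nat a1}"
  proof
    fix p assume "p \<in> ?C"
    moreover have "1 * int p \<le> int b * int p" using b by (intro mult_right_mono) auto
    ultimately show "p \<in> {..nat a1}" by simp
  qed
  then have C: "finite ?C" by (rule finite_subset) simp
  show "{(p, q). coef p q \<noteq> 0} \<subseteq> {(0, 0)} \<union> (\<Union>q\<in>?R. (\<lambda>p. (p, q)) ` {p. coef p q \<noteq> 0}) \<union> (\<Union>p\<in>?C. (\<lambda>q. (p, q)) ` {q. coef p q \<noteq> 0})"
  proof clarify
    fix p q assume *: "coef p q \<noteq> 0" "(p, q) \<notin> (\<Union>p\<in>?C. (\<lambda>q. (p, q)) ` {q. coef p q \<noteq> 0})"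
      "(p, q) \<notin> (\<Union>q\<in>?R. (\<lambda>p. (p, q)) ` {p. coef p q \<noteq> 0})" "(p, q) \<notin> {}" 
    then have out: "rowlen q = 0" "collen p = 0" by (auto simp: not_less)
    have "(p, q) = (0, 0)"
    proof (rule ccontr)
      assume nz: "(p, q) \<noteq> (0, 0)"
      have "coef p q = 0"
      proof (cases "int c * a1 * int q \<le> int b * a2 * int p")
        case True
        then show ?thesis using greedy_row[OF nz True] out recurrence_sum_0[of "\<lambda>i. coef i q" p "int b"]
          unfolding recurrence_iff by simp
      next
        case False
        then show ?thesis using greedy_col[OF nz] out recurrence_sum_0[of "\<lambda>j. coef p j" q "int c"]
          unfolding recurrence_iff by simp
      qed
      with * show False by simp
    qed
    then show "p = 0 \<and> q = 0" by simp
  qed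
  show "finite ({(0, 0)} \<union> (\<Union>q\<in>?R. (\<lambda>p. (p, q)) ` {p. coef p q \<noteq> 0}) \<union> (\<Union>p\<in>?C. (\<lambda>q. (p, q)) ` {q. coef p q \<noteq> 0}))"
    using R C greedy_row_finite greedy_col_finite by auto
qed

private abbreviation "mon_at p q \<equiv> mon (int b * int p - a1) (int c * int q - a2)"

text \<open>Rows with \<open>c q \<ge> a2\<close> involve only nonnegative powers of
  \<open>X_2\<close>; in the others the factor \<open>Bser\<close> supplies the powers of
  \<open>X_0\<close>.\<close>

lemma greedy_row_span:
  assumes "\<And>p. p > P \<Longrightarrow> coef p q = 0"
  shows "(\<Sum>p\<le>P. torus_scalar (coef p q) * mon_at p q) \<in> rowspan b (nat a2)"
proof (cases "int c * int q < a2")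
  case False
  have "mon_at p q \<in> rowset b (nat a2)" for p
    unfolding rowset_def by (rule UnI2, rule CollectI, rule exI, rule exI, rule conjI[OF _ refl]) (use False in simp)
  then show ?thesis by (intro tspan_sum tspan_scalar tspan_base)
next
  case True
  define n where "n = nat (a2 - int c * int q)"
  define N where "N = nat (int c * a1 * int q) + 1"
  \<comment> \<open>Zero coefficients extend the range until \<open>expansion_sum\<close>
    applies.\<close>
  define P' where "P' = max P (N + n)"
  let ?f = "Abs_fps (\<lambda>i. coef i q) * Hser (int b) n"
  have "(\<Sum>p\<le>P. torus_scalar (coef p q) * mon_at p q) = (\<Sum>p\<le>P'. torus_scalar (coef p q) * mon_at p q)"
    by (rule sum.mono_neutral_left) (auto simp: P'_def assms)
  also have "\<dots> = (\<Sum>i<N. torus_scalar (fps_nth ?f i) * (\<Sum>k\<le>n. torus_scalar (lbin (int b) n k) * mon_at (i + k) q))"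
    unfolding n_def by (rule expansion_sum[OF row_expansion])
      (use row_bound[OF True] in \<open>auto simp: N_def n_def P'_def\<close>)
  also have "\<dots> = (\<Sum>i<N. torus_scalar (fps_nth ?f i) * rowel b (int b * int i - a1) (int c * int q - a2))"
    by (simp add: rowel_def n_def algebra_simps)
  also have "\<dots> \<in> rowspan b (nat a2)"
  proof -
    have "int c * int q \<ge> 0" by simp
    then show ?thesis by (intro tspan_sum tspan_scalar rowel_rowspan) linarith
  qed
  finally show ?thesis .
qed

lemma greedy_col_span:
  assumes "\<And>q. q > Q \<Longrightarrow> coef p q = 0"
  shows "(\<Sum>q\<le>Q. torus_scalar (coef p q) * mon_at p q) \<in> colspan c"
proof (cases "int b * int p < a1")
  case False
  then show ?thesis by (intro tspan_sum tspan_scalar mon_colspan) auto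
next
  case True
  define n where "n = nat (a1 - int b * int p)"
  define N where "N = nat (int b * a2 * int p) + 1"
  define Q' where "Q' = max Q (N + n)"
  let ?f = "Abs_fps (\<lambda>j. coef p j) * Hser (int c) n"
  have "(\<Sum>q\<le>Q. torus_scalar (coef p q) * mon_at p q) = (\<Sum>q\<le>Q'. torus_scalar (coef p q) * mon_at p q)"
    by (rule sum.mono_neutral_left) (auto simp: Q'_def assms)
  also have "\<dots> = (\<Sum>i<N. torus_scalar (fps_nth ?f i) * (\<Sum>k\<le>n. torus_scalar (lbin (int c) n k) * mon_at p (i + k)))"
    unfolding n_def by (rule expansion_sum[OF col_expansion])
      (use col_bound[OF True] in \<open>auto simp: N_def n_def Q'_def\<close>)
  also have "\<dots> = (\<Sum>i<N. torus_scalar (fps_nth ?f i) * colel c (int b * int p - a1) (int c * int i - a2))"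
    by (simp add: colel_def n_def algebra_simps)
  also have "\<dots> \<in> colspan c"
    by (intro tspan_sum tspan_scalar colel_colspan)
  finally show ?thesis .
qed

text \<open>Summation row by row gives membership in \<open>rowspan\<close>, summation column by
  column in \<open>colspan\<close>.\<close>

lemma greedy_element_subalg: "greedy_element b c a1 a2 \<in> subalg b c"
proof -
  have fin: "finite {(p, q). coef p q \<noteq> 0}" using greedy_finite .
  define P where "P = Max (insert 0 (fst ` {(p, q). coef p q \<noteq> 0}))"
  define Q where "Q = Max (insert 0 (snd ` {(p, q). coef p q \<noteq> 0}))"
  have bound: "p \<le> P \<and> q \<le> Q" if "coef p q \<noteq> 0" for p q
  proof -
    have "p \<in> fst ` {(p, q). coef p q \<noteq> 0}" "q \<in> snd ` {(p, q). coef p q \<noteq> 0}" using that by force+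
    then show ?thesis using fin by (auto simp: P_def Q_def intro!: Max_ge)
  qed
  have "greedy_element b c a1 a2 = (\<Sum>(p, q)\<in>{..P} \<times> {..Q}. torus_scalar (coef p q) * mon_at p q)"
    unfolding greedy_element_def by (rule sum.mono_neutral_left) (use bound in auto)
  then have PQ: "greedy_element b c a1 a2 = (\<Sum>p\<le>P. \<Sum>q\<le>Q. torus_scalar (coef p q) * mon_at p q)"
    by (simp add: sum.cartesian_product)
  have QP: "greedy_element b c a1 a2 = (\<Sum>q\<le>Q. \<Sum>p\<le>P. torus_scalar (coef p q) * mon_at p q)"
    unfolding PQ by (rule sum.swap)
  have "greedy_element b c a1 a2 \<in> rowspan b (nat a2)"
    unfolding QP by (intro tspan_sum greedy_row_span) (use bound in force)
  moreover have "greedy_element b c a1 a2 \<in> colspan c"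
    unfolding PQ by (intro tspan_sum greedy_col_span) (use bound in force)
  ultimately show ?thesis using rowspan_colspan_subalg c by blast
qed

end

lemma subalg_cluster_algebra:
  assumes \<iota>: "skew_field_of_fractions \<iota>" and "x \<in> subalg b c"
  shows "\<iota> x \<in> quantum_cluster_algebra \<iota> b c"
proof -
  have hom: "\<iota> 1 = 1" "\<iota> (x + y) = \<iota> x + \<iota> y" "\<iota> (x * y) = \<iota> x * \<iota> y" and "inj \<iota>" for x y
    using \<iota> by (auto simp: skew_field_of_fractions_def)
  have inverse: "inverse (\<iota> x) = \<iota> y" if "x * y = 1" for x y
    using that by (metis hom(1,3) inverse_unique)
  have power: "\<iota> (x ^ n) = \<iota> x ^ n" for x n
    by (induction n) (simp_all add: hom)
  have mon1: "tX1 i = mon i 0" "tX2 i = mon 0 i" for i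
    by (simp_all add: torus_monomial_def tv_0 tX1_0 tX2_0)
  \<comment> \<open>The exchange relation at \<open>m = 1\<close> solved for \<open>X_0\<close>; the
    inverse of \<open>X_2\<close> comes from a monomial of the torus.\<close>
  have X0: "\<iota> (X0 b) = cluster_var \<iota> b c 0"
  proof -
    have "cluster_var \<iota> b c 0 = inverse (\<iota> (mon 0 1)) * (\<iota> (tv (int b)) * \<iota> (mon 1 0) ^ b + 1)"
      by (simp add: cluster_var_def exchange_rhs_def numeral_2_eq_2 mon1)
    also have "\<dots> = \<iota> (mon 0 (- 1) * (tv (int b) * mon 1 0 ^ b + 1))"
      by (simp add: hom power inverse[of "mon 0 1" "mon 0 (- 1)"] mon_mult)
    also have "mon 0 (- 1) * (tv (int b) * mon 1 0 ^ b + 1) = X0 b"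
      by (simp add: X0_def mon_power1 distrib_left mon_scalar mon_mult add.commute flip: torus_scalar_vpow vpow_add)
    finally show ?thesis ..
  qed
  have X3: "\<iota> (X3 c) = cluster_var \<iota> b c 3"
  proof -
    have "cluster_var \<iota> b c 3 = (\<iota> (tv (int c)) * \<iota> (mon 0 1) ^ c + 1) * inverse (\<iota> (mon 1 0))"
      by (simp add: cluster_var_def exchange_rhs_def numeral_2_eq_2 mon1)
    also have "\<dots> = \<iota> ((tv (int c) * mon 0 1 ^ c + 1) * mon (- 1) 0)"
      by (simp add: hom power inverse[of "mon 1 0" "mon (- 1) 0"] mon_mult)
    also have "(tv (int c) * mon 0 1 ^ c + 1) * mon (- 1) 0 = X3 c"
      by (simp add: X3_def mon_power1 distrib_right mon_scalar mon_mult mult.assoc add.commute flip: torus_scalar_vpow vpow_add)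
    finally show ?thesis ..
  qed
  show ?thesis using assms(2)
  proof (induction rule: subalg.induct)
    case X1
    show ?case using quantum_cluster_algebra.var[of \<iota> b c 1] by (simp add: cluster_var_1 mon1)
  next
    case X2
    show ?case using quantum_cluster_algebra.var[of \<iota> b c 2] by (simp add: cluster_var_2 mon1)
  qed (auto simp: hom X0 X3 intro: quantum_cluster_algebra.intros)
qed

section \<open>Return to \<open>qbinom\<close>, uniqueness and conclusion\<close>

lemma qbinom_recurrence_iff:
  assumes "d > 0"
  shows "to_fract (u p) = (\<Sum>k = 1..p. (-1) ^ (k - 1) * to_fract (u (p - k)) *
      qbinom (to_fract (vpow (int d))) (max a 0 + int k - 1) k) \<longleftrightarrow>
    fps_nth (Abs_fps u * Hser (int d) (nat a)) p = 0"
proof -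
  have "qbinom (to_fract (vpow (int d))) (max a 0 + int k - 1) k = to_fract (lbin (int d) (nat a + k - 1) k)"
    if "k \<in> {1..p}" for k
  proof -
    \<comment> \<open>Since \<open>k \<ge> 1\<close>, the subtraction of naturals is exact.\<close>
    have *: "max a 0 + int k - 1 = int (nat a + k - 1)" using that by auto
    show ?thesis unfolding * by (rule qbinom_lbin) (use assms in simp)
  qed
  then have *: "(\<Sum>k = 1..p. (-1) ^ (k - 1) * to_fract (u (p - k)) *
      qbinom (to_fract (vpow (int d))) (max a 0 + int k - 1) k) =
    to_fract (\<Sum>k = 1..p. (-1) ^ (k - 1) * u (p - k) * lbin (int d) (nat a + k - 1) k)"
    by (simp add: to_fract_sum power_to_fract)
  show ?thesis unfolding * recurrence_iff to_fract_eq_iff ..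
qed

lemma greedy_unique:
  assumes "e 0 0 = 1"
    and row: "\<And>p q. (p, q) \<noteq> (0, 0) \<Longrightarrow> int c * a1 * int q \<le> int b * a2 * int p \<Longrightarrow>
      fps_nth (Abs_fps (\<lambda>i. e i q) * Hser (int b) (nat (a2 - int c * int q))) p = 0"
    and col: "\<And>p q. (p, q) \<noteq> (0, 0) \<Longrightarrow> int c * a1 * int q \<ge> int b * a2 * int p \<Longrightarrow>
      fps_nth (Abs_fps (\<lambda>j. e p j) * Hser (int c) (nat (a1 - int b * int p))) q = 0"
  shows "e p q = greedy_coeff b c a1 a2 p q"
proof (induction "p + q" arbitrary: p q rule: less_induct)
  case less
  show ?case
  proof (cases "(p, q) = (0, 0)")
    case True
    then show ?thesis using assms(1) by (simp add: greedy_coeff.simps)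
  next
    case nz: False
    show ?thesis
    proof (cases "int c * a1 * int q \<le> int b * a2 * int p")
      case True
      have "e p q = (\<Sum>k = 1..p. (-1) ^ (k - 1) * e (p - k) q * lbin (int b) (nat (a2 - int c * int q) + k - 1) k)"
        using row[OF nz True] unfolding recurrence_iff .
      also have "\<dots> = greedy_coeff b c a1 a2 p q"
        using nz True by (subst greedy_coeff.simps) (auto simp: less intro!: sum.cong)
      finally show ?thesis .
    next
      case False
      then have "e p q = (\<Sum>l = 1..q. (-1) ^ (l - 1) * e p (q - l) * lbin (int c) (nat (a1 - int b * int p) + l - 1) l)"
        using col[OF nz] unfolding recurrence_iff by simp
      also have "\<dots> = greedy_coeff b c a1 a2 p q"
        using nz False by (subst greedy_coeff.simps) (auto simp: less intro!: sum.cong)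
      finally show ?thesis .
    qed
  qed
qed

theorem theorem7:
  fixes \<iota> :: "qtorus \<Rightarrow> 'f::division_ring"
    and b c :: nat and a1 a2 :: int
  assumes "skew_field_of_fractions \<iota>"
    and "b > 0" and "c > 0"
  shows "\<exists>!x. \<exists>e. pointed_with \<iota> b c a1 a2 e x \<and>
    (\<forall>p q. (p, q) \<noteq> (0, 0) \<longrightarrow>
      (int c * a1 * int q \<le> int b * a2 * int p \<longrightarrow>
        to_fract (e p q) =
          (\<Sum>k = 1..p. (-1) ^ (k - 1) * to_fract (e (p - k) q) *
            qbinom (to_fract (vpow (int b))) (max (a2 - int c * int q) 0 + int k - 1) k)) \<and>
      (int c * a1 * int q \<ge> int b * a2 * int p \<longrightarrow>
        to_fract (e p q) =
          (\<Sum>l = 1..q. (-1) ^ (l - 1) * to_fract (e p (q - l)) *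
            qbinom (to_fract (vpow (int c))) (max (a1 - int b * int p) 0 + int l - 1) l)))"
proof -
  let ?e = "greedy_coeff b c a1 a2"
  let ?rec = "\<lambda>e. \<forall>p q. (p, q) \<noteq> (0, 0) \<longrightarrow>
      (int c * a1 * int q \<le> int b * a2 * int p \<longrightarrow>
        to_fract (e p q) =
          (\<Sum>k = 1..p. (-1) ^ (k - 1) * to_fract (e (p - k) q) *
            qbinom (to_fract (vpow (int b))) (max (a2 - int c * int q) 0 + int k - 1) k)) \<and>
      (int c * a1 * int q \<ge> int b * a2 * int p \<longrightarrow>
        to_fract (e p q) =
          (\<Sum>l = 1..q. (-1) ^ (l - 1) * to_fract (e p (q - l)) *
            qbinom (to_fract (vpow (int c))) (max (a1 - int b * int p) 0 + int l - 1) l))"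
  note iff = qbinom_recurrence_iff[OF assms(2), of "\<lambda>i. e i q" for e q]
    qbinom_recurrence_iff[OF assms(3), of "\<lambda>j. e p j" for e p]
  have "?rec ?e"
    unfolding iff using greedy_row[OF assms(2,3)] greedy_col[OF assms(2,3)] by blast
  moreover have "pointed_with \<iota> b c a1 a2 ?e (\<iota> (greedy_element b c a1 a2))"
    using subalg_cluster_algebra[OF assms(1) greedy_element_subalg[OF assms(2,3)]]
      greedy_finite[OF assms(2,3)] greedy_coeff_0[OF assms(2,3)]
    by (simp add: pointed_with_def greedy_element_def)
  \<comment> \<open>The recurrence forces the coefficients, and these determine the element.\<close>
  moreover have "x = \<iota> (greedy_element b c a1 a2)" if "pointed_with \<iota> b c a1 a2 e x" "?rec e" for e x
  proof -
    have "e = ?e"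
      using that unfolding iff pointed_with_def by (intro ext greedy_unique) auto
    then show ?thesis using that(1) by (simp add: pointed_with_def greedy_element_def)
  qed
  ultimately show ?thesis by (intro ex1I[of _ "\<iota> (greedy_element b c a1 a2)"]) blast+
qed

end
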